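(* Let $\mathbb{W}$ be a 2-category with a notion of discreteness. An object $A\in\mathbb{W}$ has polymorphic products (resp. coproducts) if and only if its family fibration $\mathit{fam}_F(A)$ has products (resp. coproducts) along all morphisms. Moreover, if $\mathbb{W}$ has finite limits, then these products (resp. coproducts) are stable if and only if the products (resp. coproducts) in the family fibration satisfy the Beck-Chevalley condition.
   Context: A notion of discreteness on a 2-category $\mathbb{W}$ is given by a 1-category $\mathbb{C}$ and a 2-fully faithful functor $F\colon\mathbb{C}\to\mathbb{W}$ (each $\hom_{\mathbb{C}}(X,Y)\to\hom_{\mathbb{W}}(FX,FY)$ is an isomorphism of categories, the domain being regarded as discrete) which is left adjoint, as a functor of underlying 1-categories, to a 1-functor $U\colon\mathbb{W}\to\mathbb{C}$ with invertible unit. One identifies $\mathbb{C}$ with the full image of $F$, denoted $\mathit{Disc}(\mathbb{W})$. Family fibration: the split indexed category $\mathit{fam}_F(A)=\hom_{\mathbb{W}}(F(-),A)\colon\mathbb{C}^{op}\to\mathbf{Cat}$. Polymorphic products (coproducts): for every morphism $s\colon X\to Y$ of $\mathit{Disc}(\mathbb{W})$ and every $\tau\colon X\to A$, the right Kan extension $\prod_s\tau\colon Y\to A$ (resp. left Kan extension $\coprod_s\tau\colon Y\to A$) of $\tau$ along $s$ exists, i.e. there are bijections $\hom(h,\prod_s\tau)\cong\hom(h\circ s,\tau)$ (resp. $\hom(\coprod_s\tau,h)\cong\hom(\tau,h\circ s)$) natural in $h\colon Y\to A$. Let $\epsilon\colon(\prod_s\tau)\circ s\to\tau$ (resp. $\eta\colon\tau\to(\coprod_s\tau)\circ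 s$) be the universal 2-morphism. Stability (restricted to discrete objects): for every $s\colon X\to Y$ and $i\colon I\to Y$ in $\mathit{Disc}(\mathbb{W})$ with pullback (= comma object in $\mathit{Disc}(\mathbb{W})$) $P$, projections $\pi_1\colon P\to X$, $\pi_2\colon P\to I$, and every $\tau\colon X\to A$, the 2-morphism $\epsilon\circ\pi_1$ exhibits $(\prod_s\tau)\circ i$ as the right Kan extension of $\tau\circ\pi_1$ along $\pi_2$ (resp. $\eta\circ\pi_1$ exhibits $(\coprod_s\tau)\circ i$ as the left Kan extension of $\tau\circ\pi_1$ along $\pi_2$). An indexed category $\Phi\colon\mathbb{C}^{op}\to\mathbf{Cat}$ has products (coproducts) along all morphisms if for each $s\colon X\to Y$ in $\mathbb{C}$ the functor $\Phi(s)\colon\Phi(Y)\to\Phi(X)$ has a right adjoint $\prod_s$ (resp. left adjoint $\coprod_s$). They satisfy the Beck-Chevalley condition if for every pullback $P$ of $s\colon X\to Y$ and $i\colon I\to Y$ with projections $\pi_1\colon P\to X$, $\pi_2\colon P\to I$, the canonical natural transformation $\Phi(i)\circ\prod_s\to\prod_{\pi_2}\circ\Phi(\pi_1)$ (resp. $\coprod_{\pi_2}\circ\Phi(\pi_1)\to\Phi(i)\circ\coprod_s$) is an isomorphism. *)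

theory Defs
  imports Main
begin

section \<open>Categories, functors, adjunctions\<close>

text \<open>Composition is written in applicative order: \<open>Comp C g f\<close> is "g after f".  All fields
  are total functions, meaningful only on the carriers.\<close>

record ('o, 'm) cat =
  Obj :: "'o set"
  Arr :: "'m set"
  Dom :: "'m \<Rightarrow> 'o"
  Cod :: "'m \<Rightarrow> 'o"
  Id :: "'o \<Rightarrow> 'm"
  Comp :: "'m \<Rightarrow> 'm \<Rightarrow> 'm"

definition hom :: "('o, 'm) cat \<Rightarrow> 'o \<Rightarrow> 'o \<Rightarrow> 'm set" where
  "hom C x y = {f \<in> Arr C. Dom C f = x \<and> Cod C f = y}"

locale category =
  fixes C :: "('o, 'm) cat"
  assumes Dom_Obj: "f \<in> Arr C \<Longrightarrow> Dom C f \<in> Obj C"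
    and Cod_Obj: "f \<in> Arr C \<Longrightarrow> Cod C f \<in> Obj C"
    and Id_hom: "x \<in> Obj C \<Longrightarrow> Id C x \<in> hom C x x"
    and Comp_hom: "f \<in> hom C x y \<Longrightarrow> g \<in> hom C y z \<Longrightarrow> Comp C g f \<in> hom C x z"
    and Comp_Id: "f \<in> hom C x y \<Longrightarrow> Comp C f (Id C x) = f"
    and Id_Comp: "f \<in> hom C x y \<Longrightarrow> Comp C (Id C y) f = f"
    and Comp_assoc: "f \<in> hom C w x \<Longrightarrow> g \<in> hom C x y \<Longrightarrow> h \<in> hom C y z \<Longrightarrow>
      Comp C h (Comp C g f) = Comp C (Comp C h g) f"

definition is_iso :: "('o, 'm) cat \<Rightarrow> 'm \<Rightarrow> bool" where
  "is_iso C f \<longleftrightarrow> f \<in> Arr C \<and>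
     (\<exists>g \<in> hom C (Cod C f) (Dom C f).
        Comp C g f = Id C (Dom C f) \<and> Comp C f g = Id C (Cod C f))"

record ('o, 'm, 'p, 'n) fctr =
  fobj :: "'o \<Rightarrow> 'p"
  farr :: "'m \<Rightarrow> 'n"

definition is_functor ::
  "('o, 'm) cat \<Rightarrow> ('p, 'n) cat \<Rightarrow> ('o, 'm, 'p, 'n) fctr \<Rightarrow> bool" where
  "is_functor C D F \<longleftrightarrow>
     (\<forall>x \<in> Obj C. fobj F x \<in> Obj D) \<and>
     (\<forall>x y. \<forall>f \<in> hom C x y. farr F f \<in> hom D (fobj F x) (fobj F y)) \<and>
     (\<forall>x \<in> Obj C. farr F (Id C x) = Id D (fobj F x)) \<and>
     (\<forall>x y z. \<forall>f \<in> hom C x y. \<forall>g \<in> hom C y z.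
        farr F (Comp C g f) = Comp D (farr F g) (farr F f))"

definition id_fctr :: "('o, 'm, 'o, 'm) fctr" where
  "id_fctr = \<lparr>fobj = \<lambda>x. x, farr = \<lambda>f. f\<rparr>"

definition comp_fctr ::
  "('p, 'n, 'q, 'k) fctr \<Rightarrow> ('o, 'm, 'p, 'n) fctr \<Rightarrow> ('o, 'm, 'q, 'k) fctr" where
  "comp_fctr G F = \<lparr>fobj = \<lambda>x. fobj G (fobj F x), farr = \<lambda>f. farr G (farr F f)\<rparr>"

definition is_iso_of_categories ::
  "('o, 'm) cat \<Rightarrow> ('p, 'n) cat \<Rightarrow> ('o, 'm, 'p, 'n) fctr \<Rightarrow> bool" where
  "is_iso_of_categories C D F \<longleftrightarrow>
     is_functor C D F \<and> bij_betw (fobj F) (Obj C) (Obj D) \<and> bij_betw (farr F) (Arr C) (Arr D)"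

definition nat_trans ::
  "('o, 'm) cat \<Rightarrow> ('p, 'n) cat \<Rightarrow> ('o, 'm, 'p, 'n) fctr \<Rightarrow> ('o, 'm, 'p, 'n) fctr \<Rightarrow>
    ('o \<Rightarrow> 'n) \<Rightarrow> bool" where
  "nat_trans C D F G \<theta> \<longleftrightarrow>
     (\<forall>x \<in> Obj C. \<theta> x \<in> hom D (fobj F x) (fobj G x)) \<and>
     (\<forall>x y. \<forall>f \<in> hom C x y. Comp D (\<theta> y) (farr F f) = Comp D (farr G f) (\<theta> x))"

definition nat_iso ::
  "('o, 'm) cat \<Rightarrow> ('p, 'n) cat \<Rightarrow> ('o, 'm, 'p, 'n) fctr \<Rightarrow> ('o, 'm, 'p, 'n) fctr \<Rightarrow>
    ('o \<Rightarrow> 'n) \<Rightarrow> bool" where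
  "nat_iso C D F G \<theta> \<longleftrightarrow> nat_trans C D F G \<theta> \<and> (\<forall>x \<in> Obj C. is_iso D (\<theta> x))"

text \<open>\<open>L : C \<rightarrow> D\<close> is left adjoint to \<open>R : D \<rightarrow> C\<close> with unit \<open>\<eta>\<close> and counit \<open>\<epsilon>\<close>.\<close>

definition adjunction ::
  "('o, 'm) cat \<Rightarrow> ('p, 'n) cat \<Rightarrow> ('o, 'm, 'p, 'n) fctr \<Rightarrow> ('p, 'n, 'o, 'm) fctr \<Rightarrow>
    ('o \<Rightarrow> 'm) \<Rightarrow> ('p \<Rightarrow> 'n) \<Rightarrow> bool" where
  "adjunction C D L R \<eta> \<epsilon> \<longleftrightarrow>
     is_functor C D L \<and> is_functor D C R \<and>
     nat_trans C C id_fctr (comp_fctr R L) \<eta> \<and>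
     nat_trans D D (comp_fctr L R) id_fctr \<epsilon> \<and>
     (\<forall>x \<in> Obj C. Comp D (\<epsilon> (fobj L x)) (farr L (\<eta> x)) = Id D (fobj L x)) \<and>
     (\<forall>y \<in> Obj D. Comp C (farr R (\<epsilon> y)) (\<eta> (fobj R y)) = Id C (fobj R y))"

text \<open>The square \<open>s \<circ> p1 = i \<circ> p2\<close> is a pullback.\<close>

definition is_pullback :: "('o, 'm) cat \<Rightarrow> 'm \<Rightarrow> 'm \<Rightarrow> 'm \<Rightarrow> 'm \<Rightarrow> bool" where
  "is_pullback C s i p1 p2 \<longleftrightarrow>
     s \<in> Arr C \<and> i \<in> Arr C \<and> Cod C s = Cod C i \<and>
     p1 \<in> Arr C \<and> p2 \<in> Arr C \<and> Dom C p1 = Dom C p2 \<and>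
     Cod C p1 = Dom C s \<and> Cod C p2 = Dom C i \<and>
     Comp C s p1 = Comp C i p2 \<and>
     (\<forall>T. \<forall>q1 \<in> hom C T (Dom C s). \<forall>q2 \<in> hom C T (Dom C i).
        Comp C s q1 = Comp C i q2 \<longrightarrow>
        (\<exists>!u. u \<in> hom C T (Dom C p1) \<and> Comp C p1 u = q1 \<and> Comp C p2 u = q2))"

definition discrete_cat :: "'x set \<Rightarrow> ('x, 'x) cat" where
  "discrete_cat S = \<lparr>Obj = S, Arr = S, Dom = \<lambda>x. x, Cod = \<lambda>x. x, Id = \<lambda>x. x, Comp = \<lambda>y x. y\<rparr>"

section \<open>Strict 2-categories\<close>

text \<open>\<open>Under\<close> consists of the objects and 1-cells, \<open>Vert\<close> of the 1-cells and 2-cells with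
  vertical composition; \<open>HComp W \<beta> \<alpha>\<close> is the horizontal composite, \<open>\<alpha>\<close> first.\<close>

record ('o, 'a, 'c) twocat =
  Under :: "('o, 'a) cat"
  Vert :: "('a, 'c) cat"
  HComp :: "'c \<Rightarrow> 'c \<Rightarrow> 'c"

definition Horiz :: "('o, 'a, 'c) twocat \<Rightarrow> ('o, 'c) cat" where
  "Horiz W = \<lparr>Obj = Obj (Under W), Arr = Arr (Vert W),
     Dom = \<lambda>\<alpha>. Dom (Under W) (Dom (Vert W) \<alpha>),
     Cod = \<lambda>\<alpha>. Cod (Under W) (Cod (Vert W) \<alpha>),
     Id = \<lambda>x. Id (Vert W) (Id (Under W) x),
     Comp = HComp W\<rparr>"

locale two_category =
  fixes W :: "('o, 'a, 'c) twocat"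
  assumes Under_category: "category (Under W)"
    and Vert_category: "category (Vert W)"
    and Horiz_category: "category (Horiz W)"
    and Obj_Vert: "Obj (Vert W) = Arr (Under W)"
    and globular: "\<alpha> \<in> hom (Vert W) f g \<Longrightarrow>
      Dom (Under W) f = Dom (Under W) g \<and> Cod (Under W) f = Cod (Under W) g"
    and HComp_hom: "\<lbrakk>f \<in> hom (Under W) x y; g \<in> hom (Under W) y z;
      \<alpha> \<in> hom (Vert W) f f'; \<beta> \<in> hom (Vert W) g g'\<rbrakk> \<Longrightarrow>
      HComp W \<beta> \<alpha> \<in> hom (Vert W) (Comp (Under W) g f) (Comp (Under W) g' f')"
    and HComp_Id: "\<lbrakk>f \<in> hom (Under W) x y; g \<in> hom (Under W) y z\<rbrakk> \<Longrightarrow>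
      HComp W (Id (Vert W) g) (Id (Vert W) f) = Id (Vert W) (Comp (Under W) g f)"
    and interchange: "\<lbrakk>f \<in> hom (Under W) x y; g \<in> hom (Under W) y z;
      \<alpha> \<in> hom (Vert W) f f'; \<alpha>' \<in> hom (Vert W) f' f'';
      \<beta> \<in> hom (Vert W) g g'; \<beta>' \<in> hom (Vert W) g' g''\<rbrakk> \<Longrightarrow>
      HComp W (Comp (Vert W) \<beta>' \<beta>) (Comp (Vert W) \<alpha>' \<alpha>) =
      Comp (Vert W) (HComp W \<beta>' \<alpha>') (HComp W \<beta> \<alpha>)"

definition hom_cat :: "('o, 'a, 'c) twocat \<Rightarrow> 'o \<Rightarrow> 'o \<Rightarrow> ('a, 'c) cat" where
  "hom_cat W x y = \<lparr>Obj = hom (Under W) x y,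
     Arr = {\<alpha> \<in> Arr (Vert W). Dom (Vert W) \<alpha> \<in> hom (Under W) x y},
     Dom = Dom (Vert W), Cod = Cod (Vert W), Id = Id (Vert W), Comp = Comp (Vert W)\<rparr>"

definition whisker_right :: "('o, 'a, 'c) twocat \<Rightarrow> 'c \<Rightarrow> 'a \<Rightarrow> 'c" where
  "whisker_right W \<beta> f = HComp W \<beta> (Id (Vert W) f)"

definition whisker_left :: "('o, 'a, 'c) twocat \<Rightarrow> 'a \<Rightarrow> 'c \<Rightarrow> 'c" where
  "whisker_left W g \<alpha> = HComp W (Id (Vert W) g) \<alpha>"

subsection \<open>Finite limits\<close>

definition is_cone ::
  "('o, 'a, 'c) twocat \<Rightarrow> (nat, nat) cat \<Rightarrow> (nat, nat, 'o, 'a) fctr \<Rightarrow> 'o \<Rightarrow> (nat \<Rightarrow> 'a) \<Rightarrow> bool"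
where
  "is_cone W J D x \<mu> \<longleftrightarrow> x \<in> Obj (Under W) \<and>
     (\<forall>j \<in> Obj J. \<mu> j \<in> hom (Under W) x (fobj D j)) \<and>
     (\<forall>j k. \<forall>a \<in> hom J j k. Comp (Under W) (farr D a) (\<mu> j) = \<mu> k)"

text \<open>The clauses after the first express bijectivity on objects and on morphisms of the functor
  from \<open>hom(x, l)\<close> to the category of cones with vertex \<open>x\<close>.\<close>

definition is_two_limit ::
  "('o, 'a, 'c) twocat \<Rightarrow> (nat, nat) cat \<Rightarrow> (nat, nat, 'o, 'a) fctr \<Rightarrow> 'o \<Rightarrow> (nat \<Rightarrow> 'a) \<Rightarrow> bool"
where
  "is_two_limit W J D l \<pi> \<longleftrightarrow> is_cone W J D l \<pi> \<and>
     (\<forall>x \<mu>. is_cone W J D x \<mu> \<longrightarrow>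
        (\<exists>!u. u \<in> hom (Under W) x l \<and> (\<forall>j \<in> Obj J. Comp (Under W) (\<pi> j) u = \<mu> j))) \<and>
     (\<forall>x. \<forall>u \<in> hom (Under W) x l. \<forall>v \<in> hom (Under W) x l. \<forall>\<Theta>.
        (\<forall>j \<in> Obj J. \<Theta> j \<in> hom (Vert W) (Comp (Under W) (\<pi> j) u) (Comp (Under W) (\<pi> j) v)) \<and>
        (\<forall>j k. \<forall>a \<in> hom J j k. whisker_left W (farr D a) (\<Theta> j) = \<Theta> k) \<longrightarrow>
        (\<exists>!\<theta>. \<theta> \<in> hom (Vert W) u v \<and> (\<forall>j \<in> Obj J. whisker_left W (\<pi> j) \<theta> = \<Theta> j)))"

text \<open>\<open>\<kappa> : p \<Rightarrow> q : e \<rightarrow> a\<close> exhibits \<open>e\<close> as the cotensor of \<open>a\<close> with the arrow category: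
  whiskering with \<open>\<kappa>\<close> is an isomorphism from \<open>hom(x, e)\<close> to the arrow category of \<open>hom(x, a)\<close>.\<close>

definition is_arrow_cotensor :: "('o, 'a, 'c) twocat \<Rightarrow> 'o \<Rightarrow> 'o \<Rightarrow> 'c \<Rightarrow> bool" where
  "is_arrow_cotensor W a e \<kappa> \<longleftrightarrow> \<kappa> \<in> Arr (hom_cat W e a) \<and>
     (\<forall>x \<in> Obj (Under W). \<forall>\<alpha> \<in> Arr (hom_cat W x a).
        \<exists>!u. u \<in> hom (Under W) x e \<and> whisker_right W \<kappa> u = \<alpha>) \<and>
     (\<forall>x. \<forall>u \<in> hom (Under W) x e. \<forall>v \<in> hom (Under W) x e.
        let p = Dom (Vert W) \<kappa>; q = Cod (Vert W) \<kappa> in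
        \<forall>\<sigma> \<in> hom (Vert W) (Comp (Under W) p u) (Comp (Under W) p v).
        \<forall>\<rho> \<in> hom (Vert W) (Comp (Under W) q u) (Comp (Under W) q v).
          Comp (Vert W) (whisker_right W \<kappa> v) \<sigma> = Comp (Vert W) \<rho> (whisker_right W \<kappa> u) \<longrightarrow>
          (\<exists>!\<theta>. \<theta> \<in> hom (Vert W) u v \<and> whisker_left W p \<theta> = \<sigma> \<and> whisker_left W q \<theta> = \<rho>))"

text \<open>Finite completeness in the 2-categorical sense (Street): finite conical 2-limits and
  cotensors with the arrow category.  Every finite category is isomorphic to one whose objects
  and arrows are natural numbers, so fixing the type of the shapes is no restriction.\<close>

definition has_finite_limits :: "('o, 'a, 'c) twocat \<Rightarrow> bool" where
  "has_finite_limits W \<longleftrightarrow>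
     (\<forall>J D. category J \<and> finite (Obj J) \<and> finite (Arr J) \<and> is_functor J (Under W) D \<longrightarrow>
        (\<exists>l \<pi>. is_two_limit W J D l \<pi>)) \<and>
     (\<forall>a \<in> Obj (Under W). \<exists>e \<in> Obj (Under W). \<exists>\<kappa>. is_arrow_cotensor W a e \<kappa>)"

section \<open>Notions of discreteness\<close>

text \<open>A 2-functor from the locally discrete 2-category \<open>C\<close> to \<open>W\<close> is the same as a functor from
  \<open>C\<close> to \<open>Under W\<close>; on hom-categories it sends the identity 2-cell on \<open>f\<close>, represented in
  \<^const>\<open>discrete_cat\<close> by \<open>f\<close> itself, to the identity 2-cell on \<open>farr F f\<close>.\<close>

definition two_fully_faithful ::
  "('p, 'q) cat \<Rightarrow> ('o, 'a, 'c) twocat \<Rightarrow> ('p, 'q, 'o, 'a) fctr \<Rightarrow> bool" where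
  "two_fully_faithful C W F \<longleftrightarrow>
     (\<forall>x \<in> Obj C. \<forall>y \<in> Obj C.
        is_iso_of_categories (discrete_cat (hom C x y)) (hom_cat W (fobj F x) (fobj F y))
          \<lparr>fobj = farr F, farr = \<lambda>f. Id (Vert W) (farr F f)\<rparr>)"

definition notion_of_discreteness ::
  "('o, 'a, 'c) twocat \<Rightarrow> ('p, 'q) cat \<Rightarrow> ('p, 'q, 'o, 'a) fctr \<Rightarrow> bool" where
  "notion_of_discreteness W C F \<longleftrightarrow>
     category C \<and> is_functor C (Under W) F \<and> two_fully_faithful C W F \<and>
     (\<exists>U \<eta> \<epsilon>. adjunction C (Under W) F U \<eta> \<epsilon> \<and> (\<forall>x \<in> Obj C. is_iso C (\<eta> x)))"

text \<open>The full image of \<open>F\<close>.  Its 2-cells are all identities when \<open>F\<close> is 2-fully faithful, so it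
  is recorded as a category.\<close>

definition Disc ::
  "('o, 'a, 'c) twocat \<Rightarrow> ('p, 'q) cat \<Rightarrow> ('p, 'q, 'o, 'a) fctr \<Rightarrow> ('o, 'a) cat" where
  "Disc W C F = (Under W)\<lparr>Obj := fobj F ` Obj C,
     Arr := {f \<in> Arr (Under W). Dom (Under W) f \<in> fobj F ` Obj C \<and>
                                 Cod (Under W) f \<in> fobj F ` Obj C}\<rparr>"

section \<open>Polymorphic products and coproducts\<close>

text \<open>\<open>\<phi> h\<close> is a bijection from 2-cells \<open>h \<Rightarrow> r\<close> to 2-cells \<open>h \<circ> s \<Rightarrow> t\<close>, natural in \<open>h\<close>; the
  universal 2-cell is the image of the identity.\<close>

definition ran_bijection ::
  "('o, 'a, 'c) twocat \<Rightarrow> 'a \<Rightarrow> 'a \<Rightarrow> 'a \<Rightarrow> ('a \<Rightarrow> 'c \<Rightarrow> 'c) \<Rightarrow> bool" where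
  "ran_bijection W s t r \<phi> \<longleftrightarrow>
     s \<in> Arr (Under W) \<and> t \<in> Arr (Under W) \<and> Dom (Under W) t = Dom (Under W) s \<and>
     r \<in> hom (Under W) (Cod (Under W) s) (Cod (Under W) t) \<and>
     (\<forall>h \<in> hom (Under W) (Cod (Under W) s) (Cod (Under W) t).
        bij_betw (\<phi> h) (hom (Vert W) h r) (hom (Vert W) (Comp (Under W) h s) t)) \<and>
     (\<forall>h \<in> hom (Under W) (Cod (Under W) s) (Cod (Under W) t).
      \<forall>k \<in> hom (Under W) (Cod (Under W) s) (Cod (Under W) t).
      \<forall>\<beta> \<in> hom (Vert W) k h. \<forall>\<gamma> \<in> hom (Vert W) h r.
        \<phi> k (Comp (Vert W) \<gamma> \<beta>) = Comp (Vert W) (\<phi> h \<gamma>) (whisker_right W \<beta> s))"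

definition exhibits_ran ::
  "('o, 'a, 'c) twocat \<Rightarrow> 'a \<Rightarrow> 'a \<Rightarrow> 'a \<Rightarrow> 'c \<Rightarrow> bool" where
  "exhibits_ran W s t r \<epsilon> \<longleftrightarrow> (\<exists>\<phi>. ran_bijection W s t r \<phi> \<and> \<epsilon> = \<phi> r (Id (Vert W) r))"

definition lan_bijection ::
  "('o, 'a, 'c) twocat \<Rightarrow> 'a \<Rightarrow> 'a \<Rightarrow> 'a \<Rightarrow> ('a \<Rightarrow> 'c \<Rightarrow> 'c) \<Rightarrow> bool" where
  "lan_bijection W s t l \<phi> \<longleftrightarrow>
     s \<in> Arr (Under W) \<and> t \<in> Arr (Under W) \<and> Dom (Under W) t = Dom (Under W) s \<and>
     l \<in> hom (Under W) (Cod (Under W) s) (Cod (Under W) t) \<and>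
     (\<forall>h \<in> hom (Under W) (Cod (Under W) s) (Cod (Under W) t).
        bij_betw (\<phi> h) (hom (Vert W) l h) (hom (Vert W) t (Comp (Under W) h s))) \<and>
     (\<forall>h \<in> hom (Under W) (Cod (Under W) s) (Cod (Under W) t).
      \<forall>k \<in> hom (Under W) (Cod (Under W) s) (Cod (Under W) t).
      \<forall>\<beta> \<in> hom (Vert W) h k. \<forall>\<gamma> \<in> hom (Vert W) l h.
        \<phi> k (Comp (Vert W) \<beta> \<gamma>) = Comp (Vert W) (whisker_right W \<beta> s) (\<phi> h \<gamma>))"

definition exhibits_lan ::
  "('o, 'a, 'c) twocat \<Rightarrow> 'a \<Rightarrow> 'a \<Rightarrow> 'a \<Rightarrow> 'c \<Rightarrow> bool" where
  "exhibits_lan W s t l \<eta> \<longleftrightarrow> (\<exists>\<phi>. lan_bijection W s t l \<phi> \<and> \<eta> = \<phi> l (Id (Vert W) l))"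

text \<open>In the following, \<open>D\<close> is the category of discrete objects.  A choice of polymorphic products
  consists of \<open>Prd s t\<close> and its universal 2-cell \<open>eps s t : Prd s t \<circ> s \<Rightarrow> t\<close>.\<close>

definition has_polymorphic_products ::
  "('o, 'a, 'c) twocat \<Rightarrow> ('o, 'a) cat \<Rightarrow> 'o \<Rightarrow> bool" where
  "has_polymorphic_products W D A \<longleftrightarrow>
     (\<forall>s \<in> Arr D. \<forall>t \<in> hom (Under W) (Dom D s) A. \<exists>r \<epsilon>. exhibits_ran W s t r \<epsilon>)"

definition polymorphic_products ::
  "('o, 'a, 'c) twocat \<Rightarrow> ('o, 'a) cat \<Rightarrow> 'o \<Rightarrow> ('a \<Rightarrow> 'a \<Rightarrow> 'a) \<Rightarrow> ('a \<Rightarrow> 'a \<Rightarrow> 'c) \<Rightarrow> bool" where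
  "polymorphic_products W D A Prd eps \<longleftrightarrow>
     (\<forall>s \<in> Arr D. \<forall>t \<in> hom (Under W) (Dom D s) A. exhibits_ran W s t (Prd s t) (eps s t))"

definition stable_products ::
  "('o, 'a, 'c) twocat \<Rightarrow> ('o, 'a) cat \<Rightarrow> 'o \<Rightarrow> ('a \<Rightarrow> 'a \<Rightarrow> 'a) \<Rightarrow> ('a \<Rightarrow> 'a \<Rightarrow> 'c) \<Rightarrow> bool" where
  "stable_products W D A Prd eps \<longleftrightarrow>
     (\<forall>s i p1 p2. is_pullback D s i p1 p2 \<longrightarrow>
        (\<forall>t \<in> hom (Under W) (Dom D s) A.
           exhibits_ran W p2 (Comp (Under W) t p1)
             (Comp (Under W) (Prd s t) i) (whisker_right W (eps s t) p1)))"

definition has_polymorphic_coproducts ::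
  "('o, 'a, 'c) twocat \<Rightarrow> ('o, 'a) cat \<Rightarrow> 'o \<Rightarrow> bool" where
  "has_polymorphic_coproducts W D A \<longleftrightarrow>
     (\<forall>s \<in> Arr D. \<forall>t \<in> hom (Under W) (Dom D s) A. \<exists>l \<eta>. exhibits_lan W s t l \<eta>)"

definition polymorphic_coproducts ::
  "('o, 'a, 'c) twocat \<Rightarrow> ('o, 'a) cat \<Rightarrow> 'o \<Rightarrow> ('a \<Rightarrow> 'a \<Rightarrow> 'a) \<Rightarrow> ('a \<Rightarrow> 'a \<Rightarrow> 'c) \<Rightarrow> bool" where
  "polymorphic_coproducts W D A Cop eta \<longleftrightarrow>
     (\<forall>s \<in> Arr D. \<forall>t \<in> hom (Under W) (Dom D s) A. exhibits_lan W s t (Cop s t) (eta s t))"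

definition stable_coproducts ::
  "('o, 'a, 'c) twocat \<Rightarrow> ('o, 'a) cat \<Rightarrow> 'o \<Rightarrow> ('a \<Rightarrow> 'a \<Rightarrow> 'a) \<Rightarrow> ('a \<Rightarrow> 'a \<Rightarrow> 'c) \<Rightarrow> bool" where
  "stable_coproducts W D A Cop eta \<longleftrightarrow>
     (\<forall>s i p1 p2. is_pullback D s i p1 p2 \<longrightarrow>
        (\<forall>t \<in> hom (Under W) (Dom D s) A.
           exhibits_lan W p2 (Comp (Under W) t p1)
             (Comp (Under W) (Cop s t) i) (whisker_right W (eta s t) p1)))"

section \<open>Indexed categories\<close>

record ('p, 'q, 'x, 'y) indexed_cat =
  fibre :: "'p \<Rightarrow> ('x, 'y) cat"
  reindex :: "'q \<Rightarrow> ('x, 'y, 'x, 'y) fctr"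

definition is_indexed_cat :: "('p, 'q) cat \<Rightarrow> ('p, 'q, 'x, 'y) indexed_cat \<Rightarrow> bool" where
  "is_indexed_cat C \<Phi> \<longleftrightarrow>
     (\<forall>x \<in> Obj C. category (fibre \<Phi> x)) \<and>
     (\<forall>x y. \<forall>s \<in> hom C x y. is_functor (fibre \<Phi> y) (fibre \<Phi> x) (reindex \<Phi> s)) \<and>
     (\<forall>x \<in> Obj C.
        (\<forall>a \<in> Obj (fibre \<Phi> x). fobj (reindex \<Phi> (Id C x)) a = a) \<and>
        (\<forall>m \<in> Arr (fibre \<Phi> x). farr (reindex \<Phi> (Id C x)) m = m)) \<and>
     (\<forall>x y z. \<forall>s \<in> hom C x y. \<forall>t \<in> hom C y z.
        (\<forall>a \<in> Obj (fibre \<Phi> z).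
           fobj (reindex \<Phi> (Comp C t s)) a = fobj (reindex \<Phi> s) (fobj (reindex \<Phi> t) a)) \<and>
        (\<forall>m \<in> Arr (fibre \<Phi> z).
           farr (reindex \<Phi> (Comp C t s)) m = farr (reindex \<Phi> s) (farr (reindex \<Phi> t) m)))"

definition fam ::
  "('o, 'a, 'c) twocat \<Rightarrow> ('p, 'q, 'o, 'a) fctr \<Rightarrow> 'o \<Rightarrow> ('p, 'q, 'a, 'c) indexed_cat" where
  "fam W F A = \<lparr>fibre = \<lambda>x. hom_cat W (fobj F x) A,
     reindex = \<lambda>s. \<lparr>fobj = \<lambda>h. Comp (Under W) h (farr F s),
                    farr = \<lambda>\<beta>. whisker_right W \<beta> (farr F s)\<rparr>\<rparr>"

text \<open>A choice of products consists of right adjoints \<open>R s\<close> of the reindexing functors, with units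
  \<open>\<eta> s\<close> and counits \<open>\<epsilon> s\<close>; dually for coproducts.\<close>

definition has_products :: "('p, 'q) cat \<Rightarrow> ('p, 'q, 'x, 'y) indexed_cat \<Rightarrow> bool" where
  "has_products C \<Phi> \<longleftrightarrow>
     (\<forall>s \<in> Arr C. \<exists>R \<eta> \<epsilon>.
        adjunction (fibre \<Phi> (Cod C s)) (fibre \<Phi> (Dom C s)) (reindex \<Phi> s) R \<eta> \<epsilon>)"

definition indexed_products ::
  "('p, 'q) cat \<Rightarrow> ('p, 'q, 'x, 'y) indexed_cat \<Rightarrow> ('q \<Rightarrow> ('x, 'y, 'x, 'y) fctr) \<Rightarrow>
    ('q \<Rightarrow> 'x \<Rightarrow> 'y) \<Rightarrow> ('q \<Rightarrow> 'x \<Rightarrow> 'y) \<Rightarrow> bool" where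
  "indexed_products C \<Phi> R \<eta> \<epsilon> \<longleftrightarrow>
     (\<forall>s \<in> Arr C.
        adjunction (fibre \<Phi> (Cod C s)) (fibre \<Phi> (Dom C s)) (reindex \<Phi> s) (R s) (\<eta> s) (\<epsilon> s))"

definition has_coproducts :: "('p, 'q) cat \<Rightarrow> ('p, 'q, 'x, 'y) indexed_cat \<Rightarrow> bool" where
  "has_coproducts C \<Phi> \<longleftrightarrow>
     (\<forall>s \<in> Arr C. \<exists>L \<eta> \<epsilon>.
        adjunction (fibre \<Phi> (Dom C s)) (fibre \<Phi> (Cod C s)) L (reindex \<Phi> s) \<eta> \<epsilon>)"

definition indexed_coproducts ::
  "('p, 'q) cat \<Rightarrow> ('p, 'q, 'x, 'y) indexed_cat \<Rightarrow> ('q \<Rightarrow> ('x, 'y, 'x, 'y) fctr) \<Rightarrow>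
    ('q \<Rightarrow> 'x \<Rightarrow> 'y) \<Rightarrow> ('q \<Rightarrow> 'x \<Rightarrow> 'y) \<Rightarrow> bool" where
  "indexed_coproducts C \<Phi> L \<eta> \<epsilon> \<longleftrightarrow>
     (\<forall>s \<in> Arr C.
        adjunction (fibre \<Phi> (Dom C s)) (fibre \<Phi> (Cod C s)) (L s) (reindex \<Phi> s) (\<eta> s) (\<epsilon> s))"

text \<open>The canonical maps are the mates of the identity
  \<open>\<Phi>(p2) \<circ> \<Phi>(i) = \<Phi>(p1) \<circ> \<Phi>(s)\<close>:
  \<open>\<Phi>(i) R\<^sub>s \<rightarrow> R\<^sub>p\<^sub>2 \<Phi>(p2) \<Phi>(i) R\<^sub>s = R\<^sub>p\<^sub>2 \<Phi>(p1) \<Phi>(s) R\<^sub>s \<rightarrow> R\<^sub>p\<^sub>2 \<Phi>(p1)\<close> and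
  \<open>L\<^sub>p\<^sub>2 \<Phi>(p1) \<rightarrow> L\<^sub>p\<^sub>2 \<Phi>(p1) \<Phi>(s) L\<^sub>s = L\<^sub>p\<^sub>2 \<Phi>(p2) \<Phi>(i) L\<^sub>s \<rightarrow> \<Phi>(i) L\<^sub>s\<close>.\<close>

definition bc_map_products ::
  "('p, 'q) cat \<Rightarrow> ('p, 'q, 'x, 'y) indexed_cat \<Rightarrow> ('q \<Rightarrow> ('x, 'y, 'x, 'y) fctr) \<Rightarrow>
    ('q \<Rightarrow> 'x \<Rightarrow> 'y) \<Rightarrow> ('q \<Rightarrow> 'x \<Rightarrow> 'y) \<Rightarrow> 'q \<Rightarrow> 'q \<Rightarrow> 'q \<Rightarrow> 'q \<Rightarrow> 'x \<Rightarrow> 'y" where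
  "bc_map_products C \<Phi> R \<eta> \<epsilon> s i p1 p2 a =
     Comp (fibre \<Phi> (Dom C i))
       (farr (R p2) (farr (reindex \<Phi> p1) (\<epsilon> s a)))
       (\<eta> p2 (fobj (reindex \<Phi> i) (fobj (R s) a)))"

definition beck_chevalley_products ::
  "('p, 'q) cat \<Rightarrow> ('p, 'q, 'x, 'y) indexed_cat \<Rightarrow> ('q \<Rightarrow> ('x, 'y, 'x, 'y) fctr) \<Rightarrow>
    ('q \<Rightarrow> 'x \<Rightarrow> 'y) \<Rightarrow> ('q \<Rightarrow> 'x \<Rightarrow> 'y) \<Rightarrow> bool" where
  "beck_chevalley_products C \<Phi> R \<eta> \<epsilon> \<longleftrightarrow>
     (\<forall>s i p1 p2. is_pullback C s i p1 p2 \<longrightarrow>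
        nat_iso (fibre \<Phi> (Dom C s)) (fibre \<Phi> (Dom C i))
          (comp_fctr (reindex \<Phi> i) (R s)) (comp_fctr (R p2) (reindex \<Phi> p1))
          (bc_map_products C \<Phi> R \<eta> \<epsilon> s i p1 p2))"

definition bc_map_coproducts ::
  "('p, 'q) cat \<Rightarrow> ('p, 'q, 'x, 'y) indexed_cat \<Rightarrow> ('q \<Rightarrow> ('x, 'y, 'x, 'y) fctr) \<Rightarrow>
    ('q \<Rightarrow> 'x \<Rightarrow> 'y) \<Rightarrow> ('q \<Rightarrow> 'x \<Rightarrow> 'y) \<Rightarrow> 'q \<Rightarrow> 'q \<Rightarrow> 'q \<Rightarrow> 'q \<Rightarrow> 'x \<Rightarrow> 'y" where
  "bc_map_coproducts C \<Phi> L \<eta> \<epsilon> s i p1 p2 a =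
     Comp (fibre \<Phi> (Dom C i))
       (\<epsilon> p2 (fobj (reindex \<Phi> i) (fobj (L s) a)))
       (farr (L p2) (farr (reindex \<Phi> p1) (\<eta> s a)))"

definition beck_chevalley_coproducts ::
  "('p, 'q) cat \<Rightarrow> ('p, 'q, 'x, 'y) indexed_cat \<Rightarrow> ('q \<Rightarrow> ('x, 'y, 'x, 'y) fctr) \<Rightarrow>
    ('q \<Rightarrow> 'x \<Rightarrow> 'y) \<Rightarrow> ('q \<Rightarrow> 'x \<Rightarrow> 'y) \<Rightarrow> bool" where
  "beck_chevalley_coproducts C \<Phi> L \<eta> \<epsilon> \<longleftrightarrow>
     (\<forall>s i p1 p2. is_pullback C s i p1 p2 \<longrightarrow>
        nat_iso (fibre \<Phi> (Dom C s)) (fibre \<Phi> (Dom C i))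
          (comp_fctr (L p2) (reindex \<Phi> p1)) (comp_fctr (reindex \<Phi> i) (L s))
          (bc_map_coproducts C \<Phi> L \<eta> \<epsilon> s i p1 p2))"

subsection \<open>The family fibration is a split indexed category\<close>

lemma category_hom_cat:
  assumes "two_category W"
  shows "category (hom_cat W x y)"
proof -
  interpret two_category W by fact
  interpret V: category "Vert W" by (rule Vert_category)
  have hom_eq: "\<alpha> \<in> hom (hom_cat W x y) f g \<longleftrightarrow> \<alpha> \<in> hom (Vert W) f g \<and> f \<in> hom (Under W) x y"
    for \<alpha> f g by (auto simp: hom_def hom_cat_def)
  have cod: "g \<in> hom (Under W) x y" if "\<alpha> \<in> hom (Vert W) f g" "f \<in> hom (Under W) x y" for \<alpha> f g
  proof -
    have "g \<in> Arr (Under W)" using V.Cod_Obj that(1) Obj_Vert by (auto simp: hom_def)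
    then show ?thesis using globular[OF that(1)] that(2) by (auto simp: hom_def)
  qed
  show ?thesis
  proof
    fix f assume "f \<in> Arr (hom_cat W x y)"
    then have "f \<in> hom (Vert W) (Dom (Vert W) f) (Cod (Vert W) f)"
      "Dom (Vert W) f \<in> hom (Under W) x y"
      by (auto simp: hom_def hom_cat_def)
    then show "Dom (hom_cat W x y) f \<in> Obj (hom_cat W x y)"
      "Cod (hom_cat W x y) f \<in> Obj (hom_cat W x y)"
      using cod by (auto simp: hom_cat_def)
  next
    fix f assume "f \<in> Obj (hom_cat W x y)"
    then have f: "f \<in> hom (Under W) x y" by (simp add: hom_cat_def)
    then have "f \<in> Obj (Vert W)" using Obj_Vert by (auto simp: hom_def)
    then show "Id (hom_cat W x y) f \<in> hom (hom_cat W x y) f f"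
      using V.Id_hom f by (simp add: hom_eq) (simp add: hom_cat_def)
  qed (auto simp: hom_eq, auto simp: hom_cat_def
        intro: V.Comp_hom V.Comp_Id V.Id_Comp V.Comp_assoc)
qed

lemma is_indexed_cat_fam:
  assumes "two_category W" "notion_of_discreteness W C F"
  shows "is_indexed_cat C (fam W F A)"
proof -
  interpret two_category W by fact
  interpret U: category "Under W" by (rule Under_category)
  interpret V: category "Vert W" by (rule Vert_category)
  interpret H: category "Horiz W" by (rule Horiz_category)
  let ?U = "Under W" and ?V = "Vert W"
  have F: "is_functor C ?U F"
    using assms(2) by (simp add: notion_of_discreteness_def)
  have F_hom: "farr F f \<in> hom ?U (fobj F x) (fobj F y)" if "f \<in> hom C x y" for f x y
    using F that by (simp add: is_functor_def)
  have V_Id: "Id ?V f \<in> hom ?V f f" if "f \<in> hom ?U x y" for f x y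
    using that V.Id_hom Obj_Vert by (simp add: hom_def)
  have hom_eq: "\<alpha> \<in> hom (hom_cat W x y) f g \<longleftrightarrow> \<alpha> \<in> hom ?V f g \<and> f \<in> hom ?U x y"
    for \<alpha> f g x y by (auto simp: hom_def hom_cat_def)
  have cod: "g \<in> hom ?U x y" if "\<alpha> \<in> hom ?V f g" "f \<in> hom ?U x y" for \<alpha> f g x y
  proof -
    have "g \<in> Arr ?U" using V.Cod_Obj that(1) Obj_Vert by (auto simp: hom_def)
    then show ?thesis using globular[OF that(1)] that(2) by (auto simp: hom_def)
  qed
  have H_hom: "\<alpha> \<in> hom (Horiz W) x y" if "\<alpha> \<in> hom ?V f g" "f \<in> hom ?U x y" for \<alpha> f g x y
    using that cod[OF that] by (auto simp: Horiz_def hom_def)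
  have arrE: "\<exists>f g. m \<in> hom ?V f g \<and> f \<in> hom ?U x y" if "m \<in> Arr (hom_cat W x y)" for m x y
    using that by (auto simp: hom_cat_def hom_def)
  have whisker_functor: "is_functor (hom_cat W y A) (hom_cat W x A)
      \<lparr>fobj = \<lambda>h. Comp ?U h s, farr = \<lambda>\<beta>. whisker_right W \<beta> s\<rparr>"
    if s: "s \<in> hom ?U x y" for s x y
    unfolding is_functor_def fctr.simps
  proof (intro conjI ballI allI)
    fix h assume "h \<in> Obj (hom_cat W y A)"
    then show "Comp ?U h s \<in> Obj (hom_cat W x A)"
      using U.Comp_hom[OF s] by (simp add: hom_cat_def)
  next
    fix h k \<beta> assume "\<beta> \<in> hom (hom_cat W y A) h k"
    then show "whisker_right W \<beta> s \<in> hom (hom_cat W x A) (Comp ?U h s) (Comp ?U k s)"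
      by (auto simp: hom_eq whisker_right_def intro: HComp_hom[OF s _ V_Id[OF s]] U.Comp_hom[OF s])
  next
    fix h assume "h \<in> Obj (hom_cat W y A)"
    then show "whisker_right W (Id (hom_cat W y A) h) s = Id (hom_cat W x A) (Comp ?U h s)"
      using HComp_Id[OF s] by (simp add: hom_cat_def whisker_right_def)
  next
    fix h k l \<beta> \<gamma>
    assume "\<beta> \<in> hom (hom_cat W y A) h k" "\<gamma> \<in> hom (hom_cat W y A) k l"
    then have "HComp W (Comp ?V \<gamma> \<beta>) (Comp ?V (Id ?V s) (Id ?V s)) =
        Comp ?V (HComp W \<gamma> (Id ?V s)) (HComp W \<beta> (Id ?V s))"
      by (auto simp: hom_eq intro: interchange[OF s _ V_Id[OF s] V_Id[OF s]])
    then show "whisker_right W (Comp (hom_cat W y A) \<gamma> \<beta>) s =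
        Comp (hom_cat W x A) (whisker_right W \<gamma> s) (whisker_right W \<beta> s)"
      using V.Comp_Id[OF V_Id[OF s]] by (simp add: hom_cat_def whisker_right_def)
  qed
  have unit: "farr F (Id C x) = Id ?U (fobj F x)" if "x \<in> Obj C" for x
    using F that by (simp add: is_functor_def)
  have whisker_unit: "whisker_right W m (Id ?U x) = m" if "m \<in> Arr (hom_cat W x A)" for m x
  proof -
    obtain f g where "m \<in> hom ?V f g" "f \<in> hom ?U x A" using arrE[OF \<open>m \<in> _\<close>] by blast
    then show ?thesis using H.Comp_Id[OF H_hom] by (simp add: whisker_right_def Horiz_def)
  qed
  have whisker_comp: "whisker_right W m (Comp ?U t s) = whisker_right W (whisker_right W m t) s"
    if s: "s \<in> hom ?U x y" and t: "t \<in> hom ?U y z" and m: "m \<in> Arr (hom_cat W z A)"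
    for m s t x y z
  proof -
    obtain f g where "m \<in> hom ?V f g" "f \<in> hom ?U z A" using arrE[OF m] by blast
    then have "m \<in> hom (Horiz W) z A" by (rule H_hom)
    from H.Comp_assoc[OF H_hom[OF V_Id[OF s] s] H_hom[OF V_Id[OF t] t] this]
    show ?thesis using HComp_Id[OF s t] by (simp add: whisker_right_def Horiz_def)
  qed
  show ?thesis
    unfolding is_indexed_cat_def fam_def indexed_cat.simps fctr.simps
  proof (intro conjI ballI allI)
    fix x show "category (hom_cat W (fobj F x) A)" by (rule category_hom_cat) fact
  next
    fix x y s assume "s \<in> hom C x y"
    then show "is_functor (hom_cat W (fobj F y) A) (hom_cat W (fobj F x) A)
      \<lparr>fobj = \<lambda>h. Comp ?U h (farr F s), farr = \<lambda>\<beta>. whisker_right W \<beta> (farr F s)\<rparr>"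
      by (rule whisker_functor[OF F_hom])
  next
    fix x a assume "x \<in> Obj C" "a \<in> Obj (hom_cat W (fobj F x) A)"
    then show "Comp ?U a (farr F (Id C x)) = a"
      using U.Comp_Id by (simp add: unit hom_cat_def)
  next
    fix x m assume "x \<in> Obj C" "m \<in> Arr (hom_cat W (fobj F x) A)"
    then show "whisker_right W m (farr F (Id C x)) = m" by (simp add: unit whisker_unit)
  next
    fix x y z s t a
    assume st: "s \<in> hom C x y" "t \<in> hom C y z" and a: "a \<in> Obj (hom_cat W (fobj F z) A)"
    have "farr F (Comp C t s) = Comp ?U (farr F t) (farr F s)"
      using F st unfolding is_functor_def by blast
    then show "Comp ?U a (farr F (Comp C t s)) = Comp ?U (Comp ?U a (farr F t)) (farr F s)"
      using U.Comp_assoc[OF F_hom[OF st(1)] F_hom[OF st(2)]] a by (simp add: hom_cat_def)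
  next
    fix x y z s t m
    assume st: "s \<in> hom C x y" "t \<in> hom C y z" and m: "m \<in> Arr (hom_cat W (fobj F z) A)"
    have "farr F (Comp C t s) = Comp ?U (farr F t) (farr F s)"
      using F st unfolding is_functor_def by blast
    then show "whisker_right W m (farr F (Comp C t s)) =
        whisker_right W (whisker_right W m (farr F t)) (farr F s)"
      using whisker_comp[OF F_hom[OF st(1)] F_hom[OF st(2)] m] by simp
  qed
qed

end

theory Submission
  imports Defs
begin

text \<open>The coproduct statements are the product statements in the
  2-category \<open>co W\<close> with reversed 2-cells.  A right Kan extension along \<open>F s\<close> is a universal arrow
  from the reindexing functor along \<open>s\<close>, so having all of them amounts to a right adjoint.  The
  Beck-Chevalley map compares the reindexed universal arrow with the universal arrow along \<open>p2\<close>;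
  hence it is invertible iff the reindexed arrow is itself universal.  Since \<open>F\<close> is fully
  faithful, pullbacks in \<open>C\<close> and in the category of discrete objects correspond.\<close>

section \<open>Universal arrows and adjunctions\<close>

text \<open>Two obstacles shape the proof. The stability statement quantifies over two unrelated
  choices: \<open>Prd\<close> and \<open>eps\<close> are picked separately for each arrow and each
  family, while \<open>R\<close>, \<open>\<eta>\<close> and \<open>\<epsilon>\<close> form
  adjunctions. Nothing says that \<open>Prd s t\<close> is the value of \<open>R s\<close> at
  \<open>t\<close>, nor that \<open>Prd s\<close> acts on 2-cells. Universal arrows mediate between
  the two because they are a property of one object and one arrow, and any two of them with the same
  target differ by an isomorphism. Secondly, \<open>F\<close> is bijective on each hom-set but may
  identify objects. An arrow between discrete objects therefore has no preferred lift to
  \<open>C\<close>, and the objects of a diagram have to be lifted before its arrows.\<close>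

lemma homD:
  assumes "f \<in> hom C x y"
  shows "f \<in> Arr C" "Dom C f = x" "Cod C f = y"
  using assms by (auto simp: hom_def)

lemma is_iso_hom_iff:
  assumes "f \<in> hom C x y"
  shows "is_iso C f \<longleftrightarrow> (\<exists>g \<in> hom C y x. Comp C g f = Id C x \<and> Comp C f g = Id C y)"
  using assms by (auto simp: is_iso_def hom_def)

section \<open>Isomorphisms in a category\<close>

context category
begin

lemma hom_Obj:
  assumes "f \<in> hom C x y"
  shows "x \<in> Obj C" "y \<in> Obj C"
  using assms Dom_Obj Cod_Obj by (auto simp: hom_def)

lemma is_iso_Comp:
  assumes f: "f \<in> hom C x y" "is_iso C f" and g: "g \<in> hom C y z" "is_iso C g"
  shows "is_iso C (Comp C g f)"
proof -
  obtain f' where f': "f' \<in> hom C y x" "Comp C f' f = Id C x" "Comp C f f' = Id C y"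
    using f is_iso_hom_iff by metis
  obtain g' where g': "g' \<in> hom C z y" "Comp C g' g = Id C y" "Comp C g g' = Id C z"
    using g is_iso_hom_iff by metis
  have gf: "Comp C g f \<in> hom C x z" and fg': "Comp C f' g' \<in> hom C z x"
    using f g f' g' Comp_hom by blast+
  have "Comp C (Comp C f' g') (Comp C g f) = Comp C f' (Comp C g' (Comp C g f))"
    using Comp_assoc[OF gf g'(1) f'(1)] by simp
  also have "\<dots> = Id C x"
    using Comp_assoc[OF f(1) g(1) g'(1)] g'(2) Id_Comp[OF f(1)] f'(2) by simp
  finally have 1: "Comp C (Comp C f' g') (Comp C g f) = Id C x" .
  have "Comp C (Comp C g f) (Comp C f' g') = Comp C g (Comp C f (Comp C f' g'))"
    using Comp_assoc[OF fg' f(1) g(1)] by simp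
  also have "\<dots> = Id C z"
    using Comp_assoc[OF g'(1) f'(1) f(1)] f'(3) Id_Comp[OF g'(1)] g'(3) by simp
  finally show ?thesis using 1 gf fg' is_iso_hom_iff by metis
qed

text \<open>\<open>g\<close> is recovered from \<open>Comp C g f\<close> by precomposing with the
  inverse of \<open>f\<close>. This lets an invertible change of the chosen Kan extension be
  cancelled from a comparison map.\<close>

lemma is_iso_Comp_iff:
  assumes f: "f \<in> hom C x y" "is_iso C f" and g: "g \<in> hom C y z"
  shows "is_iso C (Comp C g f) \<longleftrightarrow> is_iso C g"
proof
  assume gf: "is_iso C (Comp C g f)"
  obtain f' where f': "f' \<in> hom C y x" "Comp C f' f = Id C x" "Comp C f f' = Id C y"
    using f is_iso_hom_iff by metis
  have "is_iso C f'" using f' f is_iso_hom_iff by metis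
  then have "is_iso C (Comp C (Comp C g f) f')"
    using is_iso_Comp[OF f'(1) _ Comp_hom[OF f(1) g] gf] by blast
  moreover have "Comp C (Comp C g f) f' = g"
    using Comp_assoc[OF f'(1) f(1) g] f'(3) Comp_Id[OF g] by simp
  ultimately show "is_iso C g" by simp
qed (use is_iso_Comp[OF f g] in blast)

end

text \<open>A terminal object of the comma category of \<open>G\<close> over \<open>t\<close>. It
  concerns a single \<open>t\<close> and no functor in the other direction, so that one Kan
  extension already is an instance.\<close>

definition universal_arrow ::
  "('o, 'm) cat \<Rightarrow> ('p, 'n) cat \<Rightarrow> ('o, 'm, 'p, 'n) fctr \<Rightarrow> 'p \<Rightarrow> 'o \<Rightarrow> 'n \<Rightarrow> bool" where
  "universal_arrow X Y G t r \<epsilon> \<longleftrightarrow>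
     r \<in> Obj X \<and> \<epsilon> \<in> hom Y (fobj G r) t \<and>
     (\<forall>h \<in> Obj X. \<forall>\<beta> \<in> hom Y (fobj G h) t.
        \<exists>!\<gamma>. \<gamma> \<in> hom X h r \<and> Comp Y \<epsilon> (farr G \<gamma>) = \<beta>)"

section \<open>Universal arrows along a fixed functor, and its right adjoints\<close>

locale functor_between = X: category X + Y: category Y
  for X :: "('o, 'm) cat" and Y :: "('p, 'n) cat" +
  fixes G :: "('o, 'm, 'p, 'n) fctr"
  assumes is_functor: "is_functor X Y G"
begin

lemma fobj_Obj: "x \<in> Obj X \<Longrightarrow> fobj G x \<in> Obj Y"
  and farr_hom: "f \<in> hom X x y \<Longrightarrow> farr G f \<in> hom Y (fobj G x) (fobj G y)"
  and farr_Id: "x \<in> Obj X \<Longrightarrow> farr G (Id X x) = Id Y (fobj G x)"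
  and farr_Comp: "f \<in> hom X x y \<Longrightarrow> g \<in> hom X y z \<Longrightarrow>
    farr G (Comp X g f) = Comp Y (farr G g) (farr G f)"
  using is_functor unfolding is_functor_def by blast+

lemma is_iso_farr:
  assumes f: "f \<in> hom X x y" "is_iso X f"
  shows "is_iso Y (farr G f)"
proof -
  obtain g where g: "g \<in> hom X y x" "Comp X g f = Id X x" "Comp X f g = Id X y"
    using f is_iso_hom_iff by metis
  have "Comp Y (farr G g) (farr G f) = Id Y (fobj G x)"
    using farr_Comp[OF f(1) g(1)] g(2) farr_Id X.hom_Obj[OF f(1)] by simp
  moreover have "Comp Y (farr G f) (farr G g) = Id Y (fobj G y)"
    using farr_Comp[OF g(1) f(1)] g(3) farr_Id X.hom_Obj[OF f(1)] by simp
  ultimately show ?thesis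
    using farr_hom[OF f(1)] farr_hom[OF g(1)] is_iso_hom_iff by metis
qed

text \<open>Naturality in the source of the passage from \<open>\<gamma>\<close> to
  \<open>Comp Y \<epsilon> (farr G \<gamma>)\<close>; transposes of composites are computed with it
  below.\<close>

lemma Comp_farr_Comp:
  assumes "f \<in> hom X w x" "g \<in> hom X x y" "\<epsilon> \<in> hom Y (fobj G y) t"
  shows "Comp Y \<epsilon> (farr G (Comp X g f)) = Comp Y (Comp Y \<epsilon> (farr G g)) (farr G f)"
  using farr_Comp[OF assms(1,2)] Y.Comp_assoc[OF farr_hom[OF assms(1)] farr_hom[OF assms(2)] assms(3)]
  by simp

text \<open>Factoring through \<open>\<epsilon>\<close> by \<open>\<delta>\<close> is factoring
  through \<open>\<epsilon>'\<close> by \<open>Comp X \<gamma> \<delta>\<close>. So universality of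
  \<open>\<epsilon>\<close> means that postcomposition with \<open>\<gamma>\<close> is bijective on
  arrows from every object, which is invertibility of \<open>\<gamma>\<close>.\<close>

lemma universal_arrow_iff_is_iso:
  assumes u: "universal_arrow X Y G t r' \<epsilon>'"
    and g: "\<gamma> \<in> hom X r r'" and e: "Comp Y \<epsilon>' (farr G \<gamma>) = \<epsilon>"
  shows "universal_arrow X Y G t r \<epsilon> \<longleftrightarrow> is_iso X \<gamma>"
proof -
  have e': "\<epsilon>' \<in> hom Y (fobj G r') t" and r': "r' \<in> Obj X"
    using u by (auto simp: universal_arrow_def)
  have uniq': "\<delta> = \<delta>'" if "\<delta> \<in> hom X h r'" "\<delta>' \<in> hom X h r'"
    "Comp Y \<epsilon>' (farr G \<delta>) = Comp Y \<epsilon>' (farr G \<delta>')" for h \<delta> \<delta>'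
    using u that X.hom_Obj(1)[OF that(1)] Y.Comp_hom[OF farr_hom[OF that(1)] e']
    unfolding universal_arrow_def by metis
  have r: "r \<in> Obj X" using X.hom_Obj[OF g] by simp
  have eh: "\<epsilon> \<in> hom Y (fobj G r) t" using Y.Comp_hom[OF farr_hom[OF g] e'] e by simp
  have ecomp: "Comp Y \<epsilon>' (farr G (Comp X \<gamma> \<delta>)) = Comp Y \<epsilon> (farr G \<delta>)"
    if "\<delta> \<in> hom X h r" for h \<delta>
    using Comp_farr_Comp[OF that g e'] e by simp
  show ?thesis
  proof
    assume u2: "universal_arrow X Y G t r \<epsilon>"
    \<comment> \<open>The candidate inverse is the factor of \<open>\<epsilon>'\<close> through
      \<open>\<epsilon>\<close>. Each composite is then identified with an identity by uniqueness of
      factors through the universal arrow at its target.\<close>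
    then obtain \<delta> where d: "\<delta> \<in> hom X r' r" "Comp Y \<epsilon> (farr G \<delta>) = \<epsilon>'"
      using r' e' unfolding universal_arrow_def by blast
    have "Comp Y \<epsilon>' (farr G (Comp X \<gamma> \<delta>)) = Comp Y \<epsilon>' (farr G (Id X r'))"
      using ecomp[OF d(1)] d(2) farr_Id[OF r'] Y.Comp_Id[OF e'] by simp
    then have 1: "Comp X \<gamma> \<delta> = Id X r'"
      using uniq' X.Comp_hom[OF d(1) g] X.Id_hom[OF r'] by blast
    have "Comp Y \<epsilon> (farr G (Comp X \<delta> \<gamma>)) = Comp Y \<epsilon> (farr G (Id X r))"
      using Comp_farr_Comp[OF g d(1) eh] d(2) e farr_Id[OF r] Y.Comp_Id[OF eh] by simp
    then have "Comp X \<delta> \<gamma> = Id X r"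
      using u2 r X.Comp_hom[OF g d(1)] X.Id_hom[OF r]
        Y.Comp_hom[OF farr_hom[OF X.Id_hom[OF r]] eh]
      unfolding universal_arrow_def by metis
    then show "is_iso X \<gamma>" using 1 is_iso_hom_iff[OF g] d(1) by blast
  next
    assume "is_iso X \<gamma>"
    then obtain \<delta> where d: "\<delta> \<in> hom X r' r" "Comp X \<delta> \<gamma> = Id X r" "Comp X \<gamma> \<delta> = Id X r'"
      using is_iso_hom_iff[OF g] by blast
    show "universal_arrow X Y G t r \<epsilon>"
      unfolding universal_arrow_def
    proof (intro conjI ballI r eh)
      fix h \<beta> assume h: "h \<in> Obj X" and b: "\<beta> \<in> hom Y (fobj G h) t"
      obtain \<kappa> where k: "\<kappa> \<in> hom X h r'" "Comp Y \<epsilon>' (farr G \<kappa>) = \<beta>"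
        using u h b unfolding universal_arrow_def by blast
      have dk: "Comp X \<delta> \<kappa> \<in> hom X h r" using X.Comp_hom[OF k(1) d(1)] .
      have "Comp X \<gamma> (Comp X \<delta> \<kappa>) = \<kappa>"
        using X.Comp_assoc[OF k(1) d(1) g] d(3) X.Id_Comp[OF k(1)] by simp
      then have ex: "Comp Y \<epsilon> (farr G (Comp X \<delta> \<kappa>)) = \<beta>" using ecomp[OF dk] k(2) by simp
      have un: "\<nu> = Comp X \<delta> \<kappa>" if n: "\<nu> \<in> hom X h r" "Comp Y \<epsilon> (farr G \<nu>) = \<beta>" for \<nu>
      proof -
        have "Comp X \<gamma> \<nu> = \<kappa>"
          using uniq'[OF X.Comp_hom[OF n(1) g] k(1)] ecomp[OF n(1)] n(2) k(2) by simp
        then show ?thesis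
          using X.Comp_assoc[OF n(1) g d(1)] d(2) X.Id_Comp[OF n(1)] by simp
      qed
      show "\<exists>!\<nu>. \<nu> \<in> hom X h r \<and> Comp Y \<epsilon> (farr G \<nu>) = \<beta>"
        using dk ex un by blast
    qed
  qed
qed

text \<open>This will compare a chosen Kan extension with the counit of an independently chosen
  adjunction.\<close>

lemma universal_arrow_unique:
  assumes u: "universal_arrow X Y G t r \<epsilon>" and u': "universal_arrow X Y G t r' \<epsilon>'"
  obtains \<iota> where "\<iota> \<in> hom X r r'" "is_iso X \<iota>" "Comp Y \<epsilon>' (farr G \<iota>) = \<epsilon>"
proof -
  obtain \<iota> where i: "\<iota> \<in> hom X r r'" "Comp Y \<epsilon>' (farr G \<iota>) = \<epsilon>"
    using u u' unfolding universal_arrow_def by blast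
  with that u universal_arrow_iff_is_iso[OF u' i] show thesis by blast
qed

lemma universal_arrow_counit:
  assumes adj: "adjunction X Y G R \<eta> \<epsilon>" and t: "t \<in> Obj Y"
  shows "universal_arrow X Y G t (fobj R t) (\<epsilon> t)"
proof -
  interpret R: functor_between Y X R
    using adj by unfold_locales (simp add: adjunction_def)
  have eta: "\<eta> x \<in> hom X x (fobj R (fobj G x))" if "x \<in> Obj X" for x
    using adj that by (auto simp: adjunction_def nat_trans_def id_fctr_def comp_fctr_def)
  have eta_nat: "Comp X (\<eta> y) f = Comp X (farr R (farr G f)) (\<eta> x)" if "f \<in> hom X x y" for f x y
    using adj that by (auto simp: adjunction_def nat_trans_def id_fctr_def comp_fctr_def)
  have eps: "\<epsilon> y \<in> hom Y (fobj G (fobj R y)) y" if "y \<in> Obj Y" for y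
    using adj that by (auto simp: adjunction_def nat_trans_def id_fctr_def comp_fctr_def)
  have eps_nat: "Comp Y (\<epsilon> y) (farr G (farr R f)) = Comp Y f (\<epsilon> x)" if "f \<in> hom Y x y" for f x y
    using adj that by (auto simp: adjunction_def nat_trans_def id_fctr_def comp_fctr_def)
  have tri1: "Comp Y (\<epsilon> (fobj G x)) (farr G (\<eta> x)) = Id Y (fobj G x)" if "x \<in> Obj X" for x
    using adj that by (auto simp: adjunction_def)
  have tri2: "Comp X (farr R (\<epsilon> y)) (\<eta> (fobj R y)) = Id X (fobj R y)" if "y \<in> Obj Y" for y
    using adj that by (auto simp: adjunction_def)
  show ?thesis
    unfolding universal_arrow_def
  proof (intro conjI ballI)
    show "fobj R t \<in> Obj X" using R.fobj_Obj t .
    show "\<epsilon> t \<in> hom Y (fobj G (fobj R t)) t" using eps t .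
    fix h \<beta> assume h: "h \<in> Obj X" and b: "\<beta> \<in> hom Y (fobj G h) t"
    \<comment> \<open>The adjoint transpose of \<open>\<beta>\<close>. That it factors
      \<open>\<beta>\<close> uses the triangle identity \<open>tri1\<close>; that it is the only
      factor uses \<open>tri2\<close>.\<close>
    let ?g = "Comp X (farr R \<beta>) (\<eta> h)"
    have Gh: "fobj G h \<in> Obj Y" using fobj_Obj h .
    have g: "?g \<in> hom X h (fobj R t)" using X.Comp_hom[OF eta[OF h] R.farr_hom[OF b]] .
    have "Comp Y (\<epsilon> t) (farr G ?g) = Comp Y (Comp Y \<beta> (\<epsilon> (fobj G h))) (farr G (\<eta> h))"
      using Comp_farr_Comp[OF eta[OF h] R.farr_hom[OF b] eps[OF t]] eps_nat[OF b] by simp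
    also have "\<dots> = \<beta>"
      using Y.Comp_assoc[OF farr_hom[OF eta[OF h]] eps[OF Gh] b] tri1[OF h] Y.Comp_Id[OF b] by simp
    finally have ex: "Comp Y (\<epsilon> t) (farr G ?g) = \<beta>" .
    have un: "\<nu> = ?g" if n: "\<nu> \<in> hom X h (fobj R t)" and "Comp Y (\<epsilon> t) (farr G \<nu>) = \<beta>" for \<nu>
    proof -
      have "farr R \<beta> = Comp X (farr R (\<epsilon> t)) (farr R (farr G \<nu>))"
        using that R.farr_Comp[OF farr_hom[OF n] eps[OF t]] by simp
      then have "?g = Comp X (farr R (\<epsilon> t)) (Comp X (farr R (farr G \<nu>)) (\<eta> h))"
        using X.Comp_assoc[OF eta[OF h] R.farr_hom[OF farr_hom[OF n]] R.farr_hom[OF eps[OF t]]]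
        by simp
      also have "\<dots> = Comp X (farr R (\<epsilon> t)) (Comp X (\<eta> (fobj R t)) \<nu>)" using eta_nat[OF n] by simp
      also have "\<dots> = \<nu>"
        using X.Comp_assoc[OF n eta[OF R.fobj_Obj[OF t]] R.farr_hom[OF eps[OF t]]]
          tri2[OF t] X.Id_Comp[OF n] by simp
      finally show ?thesis by simp
    qed
    show "\<exists>!\<nu>. \<nu> \<in> hom X h (fobj R t) \<and> Comp Y (\<epsilon> t) (farr G \<nu>) = \<beta>"
      using g ex un by blast
  qed
qed

text \<open>The pointwise construction of an adjoint: once a universal arrow is chosen for each
  \<open>t\<close>, the arrow part of \<open>R\<close> and the unit are forced, and every remaining
  equation comes from uniqueness of factors.\<close>

lemma adjunction_if_universal_arrows:
  assumes "\<And>t. t \<in> Obj Y \<Longrightarrow> \<exists>r \<epsilon>. universal_arrow X Y G t r \<epsilon>"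
  shows "\<exists>R \<eta> \<epsilon>. adjunction X Y G R \<eta> \<epsilon>"
proof -
  obtain r \<epsilon> where u: "\<And>t. t \<in> Obj Y \<Longrightarrow> universal_arrow X Y G t (r t) (\<epsilon> t)"
    using assms by metis
  have r: "r t \<in> Obj X" and eps: "\<epsilon> t \<in> hom Y (fobj G (r t)) t" if "t \<in> Obj Y" for t
    using u[OF that] by (auto simp: universal_arrow_def)
  \<comment> \<open>Transposition across the adjunction under construction. On the carriers the
    factor is unique, so \<open>THE\<close> denotes it.\<close>
  define lift where "lift t h \<beta> = (THE \<gamma>. \<gamma> \<in> hom X h (r t) \<and> Comp Y (\<epsilon> t) (farr G \<gamma>) = \<beta>)"
    for t h \<beta>
  have lift: "lift t h \<beta> \<in> hom X h (r t) \<and> Comp Y (\<epsilon> t) (farr G (lift t h \<beta>)) = \<beta>"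
    if "t \<in> Obj Y" "h \<in> Obj X" "\<beta> \<in> hom Y (fobj G h) t" for t h \<beta>
    using u[OF that(1)] that(2,3) unfolding lift_def universal_arrow_def
    by (intro theI'[where P = "\<lambda>\<gamma>. \<gamma> \<in> hom X h (r t) \<and> Comp Y (\<epsilon> t) (farr G \<gamma>) = \<beta>"]) blast
  \<comment> \<open>Arrows into \<open>r t\<close> are compared after composing with
    \<open>\<epsilon> t\<close>. Functoriality of \<open>R\<close>, naturality of the unit and the
    second triangle identity are all proved this way.\<close>
  have eq: "\<gamma> = \<delta>" if t: "t \<in> Obj Y" and "\<gamma> \<in> hom X h (r t)" "\<delta> \<in> hom X h (r t)"
    "Comp Y (\<epsilon> t) (farr G \<gamma>) = Comp Y (\<epsilon> t) (farr G \<delta>)" for t h \<gamma> \<delta>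
    using u[OF t] that X.hom_Obj(1)[OF that(2)] Y.Comp_hom[OF farr_hom[OF that(2)] eps[OF t]]
    unfolding universal_arrow_def by metis
  \<comment> \<open>Naturality of the counit dictates \<open>farr R f\<close>, and the first
    triangle identity dictates \<open>\<eta>\<close>. The endpoints of \<open>f\<close> are read off
    with \<open>Dom\<close> and \<open>Cod\<close> because \<open>farr\<close> receives only the
    arrow.\<close>
  define R where "R = \<lparr>fobj = r,
    farr = \<lambda>f. lift (Cod Y f) (r (Dom Y f)) (Comp Y f (\<epsilon> (Dom Y f)))\<rparr>"
  define \<eta> where "\<eta> x = lift (fobj G x) x (Id Y (fobj G x))" for x
  have [simp]: "fobj R = r" by (simp add: R_def)
  have R: "farr R f \<in> hom X (r x) (r y) \<and> Comp Y (\<epsilon> y) (farr G (farr R f)) = Comp Y f (\<epsilon> x)"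
    if f: "f \<in> hom Y x y" for f x y
    using lift[OF _ r Y.Comp_hom[OF eps f]] Y.hom_Obj[OF f] homD[OF f] by (simp add: R_def)
  have eta: "\<eta> x \<in> hom X x (r (fobj G x)) \<and>
      Comp Y (\<epsilon> (fobj G x)) (farr G (\<eta> x)) = Id Y (fobj G x)" if "x \<in> Obj X" for x
    unfolding \<eta>_def using lift that fobj_Obj Y.Id_hom by blast
  have F: "is_functor Y X R"
    unfolding is_functor_def
  proof (intro conjI ballI allI)
    fix y assume y: "y \<in> Obj Y"
    then show "fobj R y \<in> Obj X" using r by simp
    have "farr R (Id Y y) = Id X (r y)"
      using eq[OF y conjunct1[OF R[OF Y.Id_hom[OF y]]] X.Id_hom[OF r[OF y]]]
        R[OF Y.Id_hom[OF y]] farr_Id[OF r[OF y]] Y.Comp_Id[OF eps[OF y]] Y.Id_Comp[OF eps[OF y]]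
      by simp
    then show "farr R (Id Y y) = Id X (fobj R y)" by simp
  next
    fix x y f assume "f \<in> hom Y x y"
    then show "farr R f \<in> hom X (fobj R x) (fobj R y)" using R by simp
  next
    fix x y z f g assume f: "f \<in> hom Y x y" and g: "g \<in> hom Y y z"
    have x: "x \<in> Obj Y" and y: "y \<in> Obj Y" and z: "z \<in> Obj Y"
      using Y.hom_Obj f g by blast+
    have Rf: "farr R f \<in> hom X (r x) (r y)" and Rg: "farr R g \<in> hom X (r y) (r z)"
      using R f g by blast+
    have "Comp Y (\<epsilon> z) (farr G (Comp X (farr R g) (farr R f))) =
        Comp Y (Comp Y g (\<epsilon> y)) (farr G (farr R f))"
      using Comp_farr_Comp[OF Rf Rg eps[OF z]] R[OF g] by simp
    also have "\<dots> = Comp Y g (Comp Y f (\<epsilon> x))"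
      using Y.Comp_assoc[OF farr_hom[OF Rf] eps[OF y] g] R[OF f] by simp
    also have "\<dots> = Comp Y (\<epsilon> z) (farr G (farr R (Comp Y g f)))"
      using Y.Comp_assoc[OF eps[OF x] f g] R[OF Y.Comp_hom[OF f g]] by simp
    finally show "farr R (Comp Y g f) = Comp X (farr R g) (farr R f)"
      using eq[OF z] X.Comp_hom[OF Rf Rg] R[OF Y.Comp_hom[OF f g]] by metis
  qed
  interpret R: functor_between Y X R by unfold_locales (rule F)
  have eta_nat: "Comp X (\<eta> y) f = Comp X (farr R (farr G f)) (\<eta> x)" if f: "f \<in> hom X x y" for f x y
  proof -
    have x: "x \<in> Obj X" and y: "y \<in> Obj X" using X.hom_Obj f by blast+
    note Gf = farr_hom[OF f]
    have ex: "\<eta> x \<in> hom X x (r (fobj G x))" and ey: "\<eta> y \<in> hom X y (r (fobj G y))"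
      and RGf: "farr R (farr G f) \<in> hom X (r (fobj G x)) (r (fobj G y))"
      using eta x y R[OF Gf] by blast+
    have "Comp Y (\<epsilon> (fobj G y)) (farr G (Comp X (\<eta> y) f)) = farr G f"
      using Comp_farr_Comp[OF f ey eps[OF fobj_Obj[OF y]]] eta[OF y] Y.Id_Comp[OF Gf]
      by simp
    moreover have "Comp Y (\<epsilon> (fobj G y)) (farr G (Comp X (farr R (farr G f)) (\<eta> x))) = farr G f"
      using Comp_farr_Comp[OF ex RGf eps[OF fobj_Obj[OF y]]] R[OF Gf]
        Y.Comp_assoc[OF farr_hom[OF ex] eps[OF fobj_Obj[OF x]] Gf] eta[OF x] Y.Comp_Id[OF Gf]
      by simp
    ultimately show ?thesis
      using eq[OF fobj_Obj[OF y] X.Comp_hom[OF f ey] X.Comp_hom[OF ex RGf]] by simp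
  qed
  have tri: "Comp X (farr R (\<epsilon> y)) (\<eta> (r y)) = Id X (r y)" if y: "y \<in> Obj Y" for y
  proof -
    have e: "\<eta> (r y) \<in> hom X (r y) (r (fobj G (r y)))" using eta r y by blast
    have Re: "farr R (\<epsilon> y) \<in> hom X (r (fobj G (r y))) (r y)" using R[OF eps[OF y]] by simp
    have "Comp Y (\<epsilon> y) (farr G (Comp X (farr R (\<epsilon> y)) (\<eta> (r y)))) =
        Comp Y (Comp Y (\<epsilon> y) (\<epsilon> (fobj G (r y)))) (farr G (\<eta> (r y)))"
      using Comp_farr_Comp[OF e Re eps[OF y]] R[OF eps[OF y]] by simp
    also have "\<dots> = Comp Y (\<epsilon> y) (farr G (Id X (r y)))"
      using Y.Comp_assoc[OF farr_hom[OF e] eps[OF fobj_Obj[OF r[OF y]]] eps[OF y]]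
        eta[OF r[OF y]] farr_Id[OF r[OF y]] by simp
    finally show ?thesis using eq[OF y X.Comp_hom[OF e Re] X.Id_hom[OF r[OF y]]] by simp
  qed
  have "adjunction X Y G R \<eta> \<epsilon>"
    unfolding adjunction_def nat_trans_def
    using is_functor F eta eta_nat eps R tri by (simp add: id_fctr_def comp_fctr_def)
  then show ?thesis by blast
qed

end

section \<open>Beck-Chevalley maps as comparison maps\<close>

locale indexed_category = B: category C for C :: "('p, 'q) cat" +
  fixes \<Phi> :: "('p, 'q, 'x, 'y) indexed_cat"
  assumes is_indexed_cat: "is_indexed_cat C \<Phi>"
begin

lemma functor_between_reindex:
  assumes s: "s \<in> hom C x y"
  shows "functor_between (fibre \<Phi> y) (fibre \<Phi> x) (reindex \<Phi> s)"
  using is_indexed_cat s B.hom_Obj[OF s]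
  by (simp add: is_indexed_cat_def functor_between_def functor_between_axioms_def)

text \<open>Both sides are reindexing along the common diagonal \<open>Comp C s p1\<close>. Because
  the indexed category is split, this is an equality and not a coherent isomorphism, so the
  Beck-Chevalley map needs no inserted comparison cell.\<close>

lemma reindex_square:
  assumes "p1 \<in> hom C p x" "s \<in> hom C x y" "p2 \<in> hom C p z" "i \<in> hom C z y"
    and sq: "Comp C s p1 = Comp C i p2"
  shows "a \<in> Obj (fibre \<Phi> y) \<Longrightarrow>
      fobj (reindex \<Phi> p2) (fobj (reindex \<Phi> i) a) = fobj (reindex \<Phi> p1) (fobj (reindex \<Phi> s) a)"
    and "m \<in> Arr (fibre \<Phi> y) \<Longrightarrow>
      farr (reindex \<Phi> p2) (farr (reindex \<Phi> i) m) = farr (reindex \<Phi> p1) (farr (reindex \<Phi> s) m)"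
  using is_indexed_cat assms unfolding is_indexed_cat_def by metis+

end

text \<open>Commutativity of the square is what makes the Beck-Chevalley map well typed; the locale
  is interpreted at pullbacks later. It collects the four reindexing functors and the two right
  adjoints from which the map is built.\<close>

locale product_square = indexed_category C \<Phi>
  for C :: "('p, 'q) cat" and \<Phi> :: "('p, 'q, 'x, 'y) indexed_cat" +
  fixes R \<eta> \<epsilon> p x y z s i p1 p2
  assumes products: "indexed_products C \<Phi> R \<eta> \<epsilon>"
    and s: "s \<in> hom C x y" and i: "i \<in> hom C z y" and p1: "p1 \<in> hom C p x" and p2: "p2 \<in> hom C p z"
    and square: "Comp C s p1 = Comp C i p2"
begin

sublocale S: functor_between "fibre \<Phi> y" "fibre \<Phi> x" "reindex \<Phi> s"
  by (rule functor_between_reindex[OF s])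
sublocale I: functor_between "fibre \<Phi> y" "fibre \<Phi> z" "reindex \<Phi> i"
  by (rule functor_between_reindex[OF i])
sublocale P1: functor_between "fibre \<Phi> x" "fibre \<Phi> p" "reindex \<Phi> p1"
  by (rule functor_between_reindex[OF p1])
sublocale P2: functor_between "fibre \<Phi> z" "fibre \<Phi> p" "reindex \<Phi> p2"
  by (rule functor_between_reindex[OF p2])

lemma adj_s: "adjunction (fibre \<Phi> y) (fibre \<Phi> x) (reindex \<Phi> s) (R s) (\<eta> s) (\<epsilon> s)"
  using products homD[OF s] by (auto simp: indexed_products_def)

lemma adj_p2: "adjunction (fibre \<Phi> z) (fibre \<Phi> p) (reindex \<Phi> p2) (R p2) (\<eta> p2) (\<epsilon> p2)"
  using products homD[OF p2] by (auto simp: indexed_products_def)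

sublocale Rs: functor_between "fibre \<Phi> x" "fibre \<Phi> y" "R s"
  using adj_s by unfold_locales (simp add: adjunction_def)
sublocale Rp2: functor_between "fibre \<Phi> p" "fibre \<Phi> z" "R p2"
  using adj_p2 by unfold_locales (simp add: adjunction_def)

abbreviation "bc \<equiv> bc_map_products C \<Phi> R \<eta> \<epsilon> s i p1 p2"

lemma bc_eq:
  "bc a = Comp (fibre \<Phi> z) (farr (R p2) (farr (reindex \<Phi> p1) (\<epsilon> s a)))
    (\<eta> p2 (fobj (reindex \<Phi> i) (fobj (R s) a)))"
  using homD[OF i] by (simp add: bc_map_products_def)

lemma eps_s: "a \<in> Obj (fibre \<Phi> x) \<Longrightarrow>
    \<epsilon> s a \<in> hom (fibre \<Phi> x) (fobj (reindex \<Phi> s) (fobj (R s) a)) a"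
  and eps_s_nat: "f \<in> hom (fibre \<Phi> x) a b \<Longrightarrow>
    Comp (fibre \<Phi> x) (\<epsilon> s b) (farr (reindex \<Phi> s) (farr (R s) f)) = Comp (fibre \<Phi> x) f (\<epsilon> s a)"
  using adj_s by (auto simp: adjunction_def nat_trans_def id_fctr_def comp_fctr_def)

lemma eta_p2: "a \<in> Obj (fibre \<Phi> z) \<Longrightarrow>
    \<eta> p2 a \<in> hom (fibre \<Phi> z) a (fobj (R p2) (fobj (reindex \<Phi> p2) a))"
  and eps_p2: "b \<in> Obj (fibre \<Phi> p) \<Longrightarrow>
    \<epsilon> p2 b \<in> hom (fibre \<Phi> p) (fobj (reindex \<Phi> p2) (fobj (R p2) b)) b"
  and eps_p2_nat: "f \<in> hom (fibre \<Phi> p) b c \<Longrightarrow>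
    Comp (fibre \<Phi> p) (\<epsilon> p2 c) (farr (reindex \<Phi> p2) (farr (R p2) f)) = Comp (fibre \<Phi> p) f (\<epsilon> p2 b)"
  and triangle_p2: "a \<in> Obj (fibre \<Phi> z) \<Longrightarrow>
    Comp (fibre \<Phi> p) (\<epsilon> p2 (fobj (reindex \<Phi> p2) a)) (farr (reindex \<Phi> p2) (\<eta> p2 a)) =
    Id (fibre \<Phi> p) (fobj (reindex \<Phi> p2) a)"
  using adj_p2 by (auto simp: adjunction_def nat_trans_def id_fctr_def comp_fctr_def)

lemma universal_p2: "t \<in> Obj (fibre \<Phi> x) \<Longrightarrow>
    universal_arrow (fibre \<Phi> z) (fibre \<Phi> p) (reindex \<Phi> p2) (fobj (reindex \<Phi> p1) t)
      (fobj (R p2) (fobj (reindex \<Phi> p1) t)) (\<epsilon> p2 (fobj (reindex \<Phi> p1) t))"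
  using P2.universal_arrow_counit[OF adj_p2] P1.fobj_Obj by blast

text \<open>The domain, naturally an object reindexed along \<open>s\<close> and then
  \<open>p1\<close>, is rewritten as one reindexed along \<open>i\<close> and then
  \<open>p2\<close>. Here the identity whose mate is being formed enters.\<close>

lemma reindex_eps_s_hom:
  assumes "t \<in> Obj (fibre \<Phi> x)"
  shows "farr (reindex \<Phi> p1) (\<epsilon> s t) \<in> hom (fibre \<Phi> p)
    (fobj (reindex \<Phi> p2) (fobj (reindex \<Phi> i) (fobj (R s) t))) (fobj (reindex \<Phi> p1) t)"
  using P1.farr_hom[OF eps_s[OF assms]] reindex_square(1)[OF p1 s p2 i square] Rs.fobj_Obj[OF assms]
  by simp

lemma bc_hom:
  assumes t: "t \<in> Obj (fibre \<Phi> x)"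
  shows "bc t \<in> hom (fibre \<Phi> z) (fobj (reindex \<Phi> i) (fobj (R s) t))
    (fobj (R p2) (fobj (reindex \<Phi> p1) t))"
  unfolding bc_eq
  using I.Y.Comp_hom[OF eta_p2 Rp2.farr_hom[OF reindex_eps_s_hom[OF t]]]
    I.fobj_Obj Rs.fobj_Obj t by simp

text \<open>The transpose of the Beck-Chevalley map under the adjunction along \<open>p2\<close> is the counit
  along \<open>s\<close> reindexed along \<open>p1\<close>.\<close>

lemma eps_p2_bc:
  assumes t: "t \<in> Obj (fibre \<Phi> x)"
  shows "Comp (fibre \<Phi> p) (\<epsilon> p2 (fobj (reindex \<Phi> p1) t)) (farr (reindex \<Phi> p2) (bc t)) =
    farr (reindex \<Phi> p1) (\<epsilon> s t)"
proof -
  let ?a = "fobj (reindex \<Phi> i) (fobj (R s) t)" and ?e = "farr (reindex \<Phi> p1) (\<epsilon> s t)"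
  have a: "?a \<in> Obj (fibre \<Phi> z)" using I.fobj_Obj Rs.fobj_Obj t by simp
  note e = reindex_eps_s_hom[OF t]
  have "Comp (fibre \<Phi> p) (\<epsilon> p2 (fobj (reindex \<Phi> p1) t)) (farr (reindex \<Phi> p2) (bc t)) =
     Comp (fibre \<Phi> p) (Comp (fibre \<Phi> p) ?e (\<epsilon> p2 (fobj (reindex \<Phi> p2) ?a)))
       (farr (reindex \<Phi> p2) (\<eta> p2 ?a))"
    unfolding bc_eq
    using P2.Comp_farr_Comp[OF eta_p2[OF a] Rp2.farr_hom[OF e] eps_p2[OF P1.fobj_Obj[OF t]]]
      eps_p2_nat[OF e] by simp
  also have "\<dots> = ?e"
    using P1.Y.Comp_assoc[OF P2.farr_hom[OF eta_p2[OF a]] eps_p2[OF P2.fobj_Obj[OF a]] e]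
      triangle_p2[OF a] P1.Y.Comp_Id[OF e] by simp
  finally show ?thesis .
qed

text \<open>Both sides have the same transpose along \<open>p2\<close>: by \<open>eps_p2_bc\<close>
  the claim turns into naturality of the counit along \<open>s\<close>, reindexed along
  \<open>p1\<close>.\<close>

lemma bc_nat:
  assumes f: "f \<in> hom (fibre \<Phi> x) a b"
  shows "Comp (fibre \<Phi> z) (bc b) (farr (reindex \<Phi> i) (farr (R s) f)) =
    Comp (fibre \<Phi> z) (farr (R p2) (farr (reindex \<Phi> p1) f)) (bc a)"
proof -
  have a: "a \<in> Obj (fibre \<Phi> x)" and b: "b \<in> Obj (fibre \<Phi> x)" using S.Y.hom_Obj[OF f] by auto
  note Rf = Rs.farr_hom[OF f]
  note iRf = I.farr_hom[OF Rf] and pf = P1.farr_hom[OF f]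
  let ?l = "Comp (fibre \<Phi> z) (bc b) (farr (reindex \<Phi> i) (farr (R s) f))"
    and ?r = "Comp (fibre \<Phi> z) (farr (R p2) (farr (reindex \<Phi> p1) f)) (bc a)"
    and ?e = "\<epsilon> p2 (fobj (reindex \<Phi> p1) b)"
  have l: "?l \<in> hom (fibre \<Phi> z) (fobj (reindex \<Phi> i) (fobj (R s) a))
      (fobj (R p2) (fobj (reindex \<Phi> p1) b))"
    using I.Y.Comp_hom[OF iRf bc_hom[OF b]] .
  have r: "?r \<in> hom (fibre \<Phi> z) (fobj (reindex \<Phi> i) (fobj (R s) a))
      (fobj (R p2) (fobj (reindex \<Phi> p1) b))"
    using I.Y.Comp_hom[OF bc_hom[OF a] Rp2.farr_hom[OF pf]] .
  have "Comp (fibre \<Phi> p) ?e (farr (reindex \<Phi> p2) ?l) =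
      Comp (fibre \<Phi> p) (farr (reindex \<Phi> p1) (\<epsilon> s b))
        (farr (reindex \<Phi> p1) (farr (reindex \<Phi> s) (farr (R s) f)))"
    using P2.Comp_farr_Comp[OF iRf bc_hom[OF b] eps_p2[OF P1.fobj_Obj[OF b]]]
      eps_p2_bc[OF b] reindex_square(2)[OF p1 s p2 i square homD(1)[OF Rf]] by simp
  also have "\<dots> = farr (reindex \<Phi> p1) (Comp (fibre \<Phi> x) f (\<epsilon> s a))"
    using P1.farr_Comp[OF S.farr_hom[OF Rf] eps_s[OF b]] eps_s_nat[OF f] by simp
  also have "\<dots> = Comp (fibre \<Phi> p) (farr (reindex \<Phi> p1) f) (farr (reindex \<Phi> p1) (\<epsilon> s a))"
    using P1.farr_Comp[OF eps_s[OF a] f] .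
  also have "\<dots> = Comp (fibre \<Phi> p) (farr (reindex \<Phi> p1) f) (Comp (fibre \<Phi> p)
      (\<epsilon> p2 (fobj (reindex \<Phi> p1) a)) (farr (reindex \<Phi> p2) (bc a)))"
    using eps_p2_bc[OF a] by simp
  also have "\<dots> = Comp (fibre \<Phi> p) ?e (farr (reindex \<Phi> p2) ?r)"
    using P2.Comp_farr_Comp[OF bc_hom[OF a] Rp2.farr_hom[OF pf] eps_p2[OF P1.fobj_Obj[OF b]]]
      eps_p2_nat[OF pf]
      P1.Y.Comp_assoc[OF P2.farr_hom[OF bc_hom[OF a]] eps_p2[OF P1.fobj_Obj[OF a]] pf] by simp
  finally have "Comp (fibre \<Phi> p) ?e (farr (reindex \<Phi> p2) ?l) =
    Comp (fibre \<Phi> p) ?e (farr (reindex \<Phi> p2) ?r)" .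
  then show ?thesis
    using universal_p2[OF b] l r I.Y.hom_Obj(1)[OF l]
      P1.Y.Comp_hom[OF P2.farr_hom[OF l] eps_p2[OF P1.fobj_Obj[OF b]]]
    unfolding universal_arrow_def by metis
qed

text \<open>The given arrow \<open>e\<close> differs from the counit along \<open>s\<close> by an
  isomorphism \<open>\<iota>\<close>. The reindexed \<open>e\<close> then factors through the counit
  along \<open>p2\<close> by the reindexed \<open>\<iota>\<close> followed by \<open>bc t\<close>.
  The first of these is invertible, so invertibility of the composite rests on
  \<open>bc t\<close>.\<close>

lemma universal_arrow_reindex_iff:
  assumes t: "t \<in> Obj (fibre \<Phi> x)"
    and u: "universal_arrow (fibre \<Phi> y) (fibre \<Phi> x) (reindex \<Phi> s) t r e"
  shows "universal_arrow (fibre \<Phi> z) (fibre \<Phi> p) (reindex \<Phi> p2) (fobj (reindex \<Phi> p1) t)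
      (fobj (reindex \<Phi> i) r) (farr (reindex \<Phi> p1) e) \<longleftrightarrow> is_iso (fibre \<Phi> z) (bc t)"
proof -
  obtain \<iota> where k: "\<iota> \<in> hom (fibre \<Phi> y) r (fobj (R s) t)" "is_iso (fibre \<Phi> y) \<iota>"
    "Comp (fibre \<Phi> x) (\<epsilon> s t) (farr (reindex \<Phi> s) \<iota>) = e"
    using S.universal_arrow_unique[OF u S.universal_arrow_counit[OF adj_s t]] .
  note ik = I.farr_hom[OF k(1)]
  let ?c = "Comp (fibre \<Phi> z) (bc t) (farr (reindex \<Phi> i) \<iota>)"
  have "Comp (fibre \<Phi> p) (\<epsilon> p2 (fobj (reindex \<Phi> p1) t)) (farr (reindex \<Phi> p2) ?c) =
      Comp (fibre \<Phi> p) (farr (reindex \<Phi> p1) (\<epsilon> s t))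
        (farr (reindex \<Phi> p1) (farr (reindex \<Phi> s) \<iota>))"
    using P2.Comp_farr_Comp[OF ik bc_hom[OF t] eps_p2[OF P1.fobj_Obj[OF t]]]
      eps_p2_bc[OF t] reindex_square(2)[OF p1 s p2 i square homD(1)[OF k(1)]] by simp
  also have "\<dots> = farr (reindex \<Phi> p1) e"
    using P1.farr_Comp[OF S.farr_hom[OF k(1)] eps_s[OF t]] k(3) by simp
  finally show ?thesis
    using P2.universal_arrow_iff_is_iso[OF universal_p2[OF t] I.Y.Comp_hom[OF ik bc_hom[OF t]]]
      I.Y.is_iso_Comp_iff[OF ik I.is_iso_farr[OF k(1,2)] bc_hom[OF t]] by simp
qed

end

text \<open>Naturality is supplied by \<open>bc_nat\<close>, so the Beck-Chevalley condition becomes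
  a condition on one \<open>t\<close> at a time, as stability is.\<close>

lemma (in indexed_category) beck_chevalley_products_iff:
  assumes "indexed_products C \<Phi> R \<eta> \<epsilon>"
  shows "beck_chevalley_products C \<Phi> R \<eta> \<epsilon> \<longleftrightarrow>
    (\<forall>s i p1 p2. is_pullback C s i p1 p2 \<longrightarrow> (\<forall>t \<in> Obj (fibre \<Phi> (Dom C s)).
       is_iso (fibre \<Phi> (Dom C i)) (bc_map_products C \<Phi> R \<eta> \<epsilon> s i p1 p2 t)))"
proof -
  have "nat_trans (fibre \<Phi> (Dom C s)) (fibre \<Phi> (Dom C i))
      (comp_fctr (reindex \<Phi> i) (R s)) (comp_fctr (R p2) (reindex \<Phi> p1))
      (bc_map_products C \<Phi> R \<eta> \<epsilon> s i p1 p2)" if "is_pullback C s i p1 p2" for s i p1 p2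
  proof -
    interpret product_square C \<Phi> R \<eta> \<epsilon> "Dom C p1" "Dom C s" "Cod C s" "Dom C i" s i p1 p2
      using that assms by unfold_locales (auto simp: is_pullback_def hom_def)
    show ?thesis using bc_hom bc_nat by (auto simp: nat_trans_def comp_fctr_def)
  qed
  then show ?thesis by (auto simp: beck_chevalley_products_def nat_iso_def)
qed

section \<open>Discrete objects and the family fibration\<close>

text \<open>Packaged as a locale so that it can be interpreted a second time, at
  \<open>co W\<close>, for the coproduct half.\<close>

locale discreteness = two_category W for W :: "('o, 'a, 'c) twocat" +
  fixes C :: "('p, 'q) cat" and F :: "('p, 'q, 'o, 'a) fctr"
  assumes discreteness: "notion_of_discreteness W C F"
begin

sublocale U: category "Under W" by (rule Under_category)
sublocale F: functor_between C "Under W" F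
  using discreteness Under_category
  by (simp add: notion_of_discreteness_def functor_between_def functor_between_axioms_def)

text \<open>Read on objects, the isomorphism of hom-categories says that \<open>F\<close> is fully
  faithful on 1-cells.\<close>

lemma farr_bij_betw:
  assumes "x \<in> Obj C" "y \<in> Obj C"
  shows "bij_betw (farr F) (hom C x y) (hom (Under W) (fobj F x) (fobj F y))"
  using discreteness assms
  by (auto simp: notion_of_discreteness_def two_fully_faithful_def is_iso_of_categories_def
      discrete_cat_def hom_cat_def)

lemma farr_eq_iff:
  assumes "f \<in> hom C x y" "g \<in> hom C x y"
  shows "farr F f = farr F g \<longleftrightarrow> f = g"
  using farr_bij_betw[OF F.X.hom_Obj[OF assms(1)]] assms by (auto simp: bij_betw_def inj_on_def)

text \<open>The endpoints of the lift are prescribed, since objects of \<open>C\<close> with the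
  same image cannot be told apart from \<open>f\<close>.\<close>

lemma lift_arrow:
  assumes "f \<in> hom (Under W) (fobj F x) (fobj F y)" "x \<in> Obj C" "y \<in> Obj C"
  obtains s where "s \<in> hom C x y" "f = farr F s"
  using farr_bij_betw[OF assms(2,3)] assms(1) by (auto simp: bij_betw_def)

section \<open>Arrows and pullbacks among discrete objects\<close>

lemma Disc_simps [simp]:
  "Obj (Disc W C F) = fobj F ` Obj C" "Dom (Disc W C F) = Dom (Under W)"
  "Cod (Disc W C F) = Cod (Under W)" "Comp (Disc W C F) = Comp (Under W)"
  by (auto simp: Disc_def)

lemma farr_hom_Disc: "s \<in> hom C x y \<Longrightarrow> farr F s \<in> hom (Disc W C F) (fobj F x) (fobj F y)"
  using F.farr_hom[of s x y] F.X.hom_Obj[of s x y] by (auto simp: hom_def Disc_def)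

lemma hom_Disc: "f \<in> hom (Disc W C F) a b \<Longrightarrow> f \<in> hom (Under W) a b"
  by (auto simp: hom_def Disc_def)

lemma Disc_arrowE:
  assumes "f \<in> Arr (Disc W C F)"
  obtains s x y where "s \<in> hom C x y" "f = farr F s"
proof -
  obtain x y where "x \<in> Obj C" "y \<in> Obj C" "f \<in> hom (Under W) (fobj F x) (fobj F y)"
    using assms by (auto simp: Disc_def hom_def)
  with that show thesis using lift_arrow by metis
qed

text \<open>Full faithfulness carries cones and mediating arrows in both directions. The vertex of
  any cone in \<open>Disc W C F\<close> has the form \<open>fobj F T\<close>, so testing against
  objects of \<open>C\<close> misses nothing.\<close>

lemma is_pullback_Disc_iff:
  assumes s: "s \<in> hom C x y" and i: "i \<in> hom C z y" and p1: "p1 \<in> hom C p x" and p2: "p2 \<in> hom C p z"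
  shows "is_pullback (Disc W C F) (farr F s) (farr F i) (farr F p1) (farr F p2) \<longleftrightarrow>
    is_pullback C s i p1 p2"
proof -
  note arrs = homD[OF s] homD[OF i] homD[OF p1] homD[OF p2]
    homD[OF farr_hom_Disc[OF s], simplified] homD[OF farr_hom_Disc[OF i], simplified]
    homD[OF farr_hom_Disc[OF p1], simplified] homD[OF farr_hom_Disc[OF p2], simplified]
  have Obj: "x \<in> Obj C" "z \<in> Obj C" "p \<in> Obj C"
    using F.X.hom_Obj[OF s] F.X.hom_Obj[OF i] F.X.hom_Obj[OF p1] by simp_all
  have eq: "Comp (Under W) (farr F g) (farr F f) = Comp (Under W) (farr F g') (farr F f') \<longleftrightarrow>
      Comp C g f = Comp C g' f'"
    if "f \<in> hom C a b" "g \<in> hom C b c" "f' \<in> hom C a b'" "g' \<in> hom C b' c" for f g f' g' a b b' c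
    using that farr_eq_iff[OF F.X.Comp_hom F.X.Comp_hom, of f a b g c f' b' g'] F.farr_Comp by metis
  have eq1: "Comp (Under W) (farr F g) (farr F f) = farr F h \<longleftrightarrow> Comp C g f = h"
    if "f \<in> hom C a b" "g \<in> hom C b c" "h \<in> hom C a c" for f g h a b c
    using farr_eq_iff[OF F.X.Comp_hom[OF that(1,2)] that(3)] F.farr_Comp[OF that(1,2)] by simp
  have unique_iff: "(\<exists>!v. v \<in> hom (Disc W C F) (fobj F T) (fobj F p) \<and>
        Comp (Under W) (farr F p1) v = farr F q1 \<and> Comp (Under W) (farr F p2) v = farr F q2) \<longleftrightarrow>
      (\<exists>!u. u \<in> hom C T p \<and> Comp C p1 u = q1 \<and> Comp C p2 u = q2)" (is "(\<exists>!v. ?P v) \<longleftrightarrow> (\<exists>!u. ?Q u)")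
    if q: "q1 \<in> hom C T x" "q2 \<in> hom C T z" for T q1 q2
  proof -
    have T: "T \<in> Obj C" using F.X.hom_Obj[OF q(1)] by simp
    have P_iff: "?P (farr F u) \<longleftrightarrow> ?Q u" if "u \<in> hom C T p" for u
      using that farr_hom_Disc[OF that] eq1[OF that p1 q(1)] eq1[OF that p2 q(2)] by simp
    have P_lift: "\<exists>u. ?Q u \<and> v = farr F u" if "?P v" for v
      using that lift_arrow[OF hom_Disc T Obj(3)] P_iff by metis
    show ?thesis
    proof
      assume ex1: "\<exists>!v. ?P v"
      then obtain u where u: "?Q u" using P_lift by blast
      have "u' = u" if "?Q u'" for u'
        using ex1 u that P_iff[of u] P_iff[of u'] farr_eq_iff[of u' T p u] by blast
      with u show "\<exists>!u. ?Q u" by blast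
    next
      assume ex1: "\<exists>!u. ?Q u"
      then obtain u where u: "?Q u" by blast
      then have "?P (farr F u)" using P_iff by blast
      moreover have "v = farr F u" if "?P v" for v using P_lift[OF that] ex1 u by blast
      ultimately show "\<exists>!v. ?P v" by blast
    qed
  qed
  have "(\<forall>S. \<forall>f1 \<in> hom (Disc W C F) S (fobj F x). \<forall>f2 \<in> hom (Disc W C F) S (fobj F z).
        Comp (Under W) (farr F s) f1 = Comp (Under W) (farr F i) f2 \<longrightarrow>
        (\<exists>!v. v \<in> hom (Disc W C F) S (fobj F p) \<and>
          Comp (Under W) (farr F p1) v = f1 \<and> Comp (Under W) (farr F p2) v = f2)) \<longleftrightarrow>
      (\<forall>T. \<forall>q1 \<in> hom C T x. \<forall>q2 \<in> hom C T z. Comp C s q1 = Comp C i q2 \<longrightarrow>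
        (\<exists>!u. u \<in> hom C T p \<and> Comp C p1 u = q1 \<and> Comp C p2 u = q2))" (is "?L \<longleftrightarrow> ?R")
  proof
    assume L: ?L
    show ?R
    proof (intro allI ballI impI)
      fix T q1 q2 assume q: "q1 \<in> hom C T x" "q2 \<in> hom C T z" "Comp C s q1 = Comp C i q2"
      show "\<exists>!u. u \<in> hom C T p \<and> Comp C p1 u = q1 \<and> Comp C p2 u = q2"
        using L farr_hom_Disc[OF q(1)] farr_hom_Disc[OF q(2)] eq[OF q(1) s q(2) i] q(3)
          unique_iff[OF q(1,2)] by blast
    qed
  next
    assume R: ?R
    show ?L
    proof (intro allI ballI impI)
      fix S f1 f2
      assume f: "f1 \<in> hom (Disc W C F) S (fobj F x)" "f2 \<in> hom (Disc W C F) S (fobj F z)"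
        and sq: "Comp (Under W) (farr F s) f1 = Comp (Under W) (farr F i) f2"
      \<comment> \<open>Any \<open>T\<close> over \<open>S\<close> will do, provided both legs are
        lifted with the same one; otherwise the lifts need not form a cone.\<close>
      obtain T where T: "T \<in> Obj C" "S = fobj F T" using f(1) by (auto simp: hom_def Disc_def)
      obtain q1 where q1: "q1 \<in> hom C T x" "f1 = farr F q1"
        using lift_arrow hom_Disc[OF f(1)] T Obj by metis
      obtain q2 where q2: "q2 \<in> hom C T z" "f2 = farr F q2"
        using lift_arrow hom_Disc[OF f(2)] T Obj by metis
      show "\<exists>!v. v \<in> hom (Disc W C F) S (fobj F p) \<and>
          Comp (Under W) (farr F p1) v = f1 \<and> Comp (Under W) (farr F p2) v = f2"
        using R q1 q2 sq T(2) eq[OF q1(1) s q2(1) i] unique_iff[OF q1(1) q2(1)] by simp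
    qed
  qed
  then show ?thesis using eq[OF p1 s p2 i] by (simp add: is_pullback_def arrs)
qed

lemma Disc_pullbackE:
  assumes "is_pullback (Disc W C F) f g q1 q2"
  obtains s i p1 p2 p x y z where
    "s \<in> hom C x y" "i \<in> hom C z y" "p1 \<in> hom C p x" "p2 \<in> hom C p z"
    "f = farr F s" "g = farr F i" "q1 = farr F p1" "q2 = farr F p2" "is_pullback C s i p1 p2"
proof -
  have arr: "{f, g, q1, q2} \<subseteq> Arr (Disc W C F)"
    using assms by (simp add: is_pullback_def)
  \<comment> \<open>All objects are fixed before any arrow is lifted: \<open>y\<close> serves as
    codomain for both \<open>f\<close> and \<open>g\<close>, and \<open>p\<close> as domain for both
    projections, so the four lifts form a square in \<open>C\<close>.\<close>
  then obtain x y z p where Obj: "x \<in> Obj C" "y \<in> Obj C" "z \<in> Obj C" "p \<in> Obj C"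
    and eq: "Dom (Under W) f = fobj F x" "Cod (Under W) f = fobj F y"
      "Dom (Under W) g = fobj F z" "Dom (Under W) q1 = fobj F p"
    by (auto simp: Disc_def)
  have hom: "f \<in> hom (Under W) (fobj F x) (fobj F y)" "g \<in> hom (Under W) (fobj F z) (fobj F y)"
    "q1 \<in> hom (Under W) (fobj F p) (fobj F x)" "q2 \<in> hom (Under W) (fobj F p) (fobj F z)"
    using assms arr eq by (auto simp: is_pullback_def hom_def Disc_def)
  obtain s where s: "s \<in> hom C x y" "f = farr F s" using lift_arrow[OF hom(1) Obj(1,2)] .
  obtain i where i: "i \<in> hom C z y" "g = farr F i" using lift_arrow[OF hom(2) Obj(3,2)] .
  obtain p1 where p1: "p1 \<in> hom C p x" "q1 = farr F p1" using lift_arrow[OF hom(3) Obj(4,1)] .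
  obtain p2 where p2: "p2 \<in> hom C p z" "q2 = farr F p2" using lift_arrow[OF hom(4) Obj(4,3)] .
  show thesis
    using that[OF s(1) i(1) p1(1) p2(1) s(2) i(2) p1(2) p2(2)] assms
      is_pullback_Disc_iff[OF s(1) i(1) p1(1) p2(1)] s(2) i(2) p1(2) p2(2) by simp
qed

lemma hom_hom_cat: "hom (hom_cat W a b) f g = (if f \<in> hom (Under W) a b then hom (Vert W) f g else {})"
  by (auto simp: hom_cat_def hom_def)

lemma fam_simps [simp]:
  "fibre (fam W F A) x = hom_cat W (fobj F x) A"
  "fobj (reindex (fam W F A) s) h = Comp (Under W) h (farr F s)"
  "farr (reindex (fam W F A) s) \<beta> = whisker_right W \<beta> (farr F s)"
  by (simp_all add: fam_def)

lemma hom_cat_simps [simp]: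
  "Obj (hom_cat W a b) = hom (Under W) a b" "Comp (hom_cat W a b) = Comp (Vert W)"
  "Id (hom_cat W a b) = Id (Vert W)"
  by (simp_all add: hom_cat_def)

sublocale fam: indexed_category C "fam W F A" for A
  by unfold_locales (rule is_indexed_cat_fam[OF two_category_axioms discreteness])

text \<open>The Yoneda argument: a bijection natural in \<open>h\<close> is composition with the
  image of the identity, so \<open>\<phi>\<close> carries no data beyond \<open>\<epsilon>\<close>,
  and its bijectivity is existence and uniqueness of factors.\<close>

lemma exhibits_ran_iff_universal_arrow:
  assumes s: "s \<in> hom C x y" and t: "t \<in> hom (Under W) (fobj F x) A"
  shows "exhibits_ran W (farr F s) t r \<epsilon> \<longleftrightarrow>
    universal_arrow (fibre (fam W F A) y) (fibre (fam W F A) x) (reindex (fam W F A) s) t r \<epsilon>"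
proof -
  interpret S: functor_between "fibre (fam W F A) y" "fibre (fam W F A) x" "reindex (fam W F A) s"
    by (rule fam.functor_between_reindex[OF s])
  let ?s = "farr F s" and ?Y = "hom (Under W) (fobj F y) A"
  note Fs = F.farr_hom[OF s]
  have hs: "Comp (Under W) h ?s \<in> hom (Under W) (fobj F x) A" if "h \<in> ?Y" for h
    using U.Comp_hom[OF Fs that] .
  have univ_iff: "universal_arrow (fibre (fam W F A) y) (fibre (fam W F A) x)
      (reindex (fam W F A) s) t r \<epsilon> \<longleftrightarrow>
    r \<in> ?Y \<and> \<epsilon> \<in> hom (Vert W) (Comp (Under W) r ?s) t \<and>
    (\<forall>h \<in> ?Y. \<forall>\<beta> \<in> hom (Vert W) (Comp (Under W) h ?s) t.
      \<exists>!\<gamma>. \<gamma> \<in> hom (Vert W) h r \<and> Comp (Vert W) \<epsilon> (whisker_right W \<gamma> ?s) = \<beta>)"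
    using hs by (auto simp: universal_arrow_def hom_hom_cat)
  have ran_iff: "ran_bijection W ?s t r \<phi> \<longleftrightarrow> r \<in> ?Y \<and>
    (\<forall>h \<in> ?Y. bij_betw (\<phi> h) (hom (Vert W) h r) (hom (Vert W) (Comp (Under W) h ?s) t)) \<and>
    (\<forall>h \<in> ?Y. \<forall>k \<in> ?Y. \<forall>\<beta> \<in> hom (Vert W) k h. \<forall>\<gamma> \<in> hom (Vert W) h r.
        \<phi> k (Comp (Vert W) \<gamma> \<beta>) = Comp (Vert W) (\<phi> h \<gamma>) (whisker_right W \<beta> ?s))" for \<phi>
    using homD[OF Fs] homD[OF t] by (simp add: ran_bijection_def)
  show ?thesis
    unfolding univ_iff
  proof
    assume "exhibits_ran W ?s t r \<epsilon>"
    then obtain \<phi> where phi: "ran_bijection W ?s t r \<phi>" "\<epsilon> = \<phi> r (Id (Vert W) r)"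
      by (auto simp: exhibits_ran_def)
    have r: "r \<in> ?Y"
      and bij: "\<And>h. h \<in> ?Y \<Longrightarrow>
        bij_betw (\<phi> h) (hom (Vert W) h r) (hom (Vert W) (Comp (Under W) h ?s) t)"
      and nat: "\<And>h k \<beta> \<gamma>. h \<in> ?Y \<Longrightarrow> k \<in> ?Y \<Longrightarrow> \<beta> \<in> hom (Vert W) k h \<Longrightarrow> \<gamma> \<in> hom (Vert W) h r \<Longrightarrow>
        \<phi> k (Comp (Vert W) \<gamma> \<beta>) = Comp (Vert W) (\<phi> h \<gamma>) (whisker_right W \<beta> ?s)"
      using phi(1) unfolding ran_iff by blast+
    have id: "Id (Vert W) r \<in> hom (Vert W) r r"
      using S.X.Id_hom[of r] r by (simp add: hom_hom_cat)
    \<comment> \<open>Naturality of \<open>\<phi>\<close>, applied to \<open>\<gamma>\<close>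
      written as the identity of \<open>r\<close> after \<open>\<gamma>\<close>.\<close>
    have phi_eq: "\<phi> h \<gamma> = Comp (Vert W) \<epsilon> (whisker_right W \<gamma> ?s)"
      if "h \<in> ?Y" "\<gamma> \<in> hom (Vert W) h r" for h \<gamma>
      using nat[OF r that id] S.X.Id_Comp[of \<gamma> h r] that phi(2) by (simp add: hom_hom_cat)
    have "\<epsilon> \<in> hom (Vert W) (Comp (Under W) r ?s) t"
      using bij[OF r] id phi(2) by (auto simp: bij_betw_def)
    moreover have "\<exists>!\<gamma>. \<gamma> \<in> hom (Vert W) h r \<and> Comp (Vert W) \<epsilon> (whisker_right W \<gamma> ?s) = \<beta>"
      if h: "h \<in> ?Y" and b: "\<beta> \<in> hom (Vert W) (Comp (Under W) h ?s) t" for h \<beta>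
    proof -
      have inj: "inj_on (\<phi> h) (hom (Vert W) h r)" and "\<beta> \<in> \<phi> h ` hom (Vert W) h r"
        using bij[OF h] b by (simp_all add: bij_betw_def)
      then obtain \<gamma> where g: "\<gamma> \<in> hom (Vert W) h r" "\<phi> h \<gamma> = \<beta>" by blast
      show ?thesis
      proof (rule ex1I[of _ \<gamma>])
        show "\<gamma> \<in> hom (Vert W) h r \<and> Comp (Vert W) \<epsilon> (whisker_right W \<gamma> ?s) = \<beta>"
          using g phi_eq[OF h] by simp
      next
        fix \<delta> assume d: "\<delta> \<in> hom (Vert W) h r \<and> Comp (Vert W) \<epsilon> (whisker_right W \<delta> ?s) = \<beta>"
        then have "\<phi> h \<delta> = \<phi> h \<gamma>" using g phi_eq[OF h] by simp
        with inj d g show "\<delta> = \<gamma>" by (auto dest: inj_onD)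
      qed
    qed
    ultimately show "r \<in> ?Y \<and> \<epsilon> \<in> hom (Vert W) (Comp (Under W) r ?s) t \<and>
      (\<forall>h \<in> ?Y. \<forall>\<beta> \<in> hom (Vert W) (Comp (Under W) h ?s) t.
        \<exists>!\<gamma>. \<gamma> \<in> hom (Vert W) h r \<and> Comp (Vert W) \<epsilon> (whisker_right W \<gamma> ?s) = \<beta>)"
      using r by blast
  next
    assume u: "r \<in> ?Y \<and> \<epsilon> \<in> hom (Vert W) (Comp (Under W) r ?s) t \<and>
      (\<forall>h \<in> ?Y. \<forall>\<beta> \<in> hom (Vert W) (Comp (Under W) h ?s) t.
        \<exists>!\<gamma>. \<gamma> \<in> hom (Vert W) h r \<and> Comp (Vert W) \<epsilon> (whisker_right W \<gamma> ?s) = \<beta>)"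
    then have r: "r \<in> ?Y" and e: "\<epsilon> \<in> hom (Vert W) (Comp (Under W) r ?s) t" by blast+
    \<comment> \<open>The only possible formula, by the argument just given; functoriality of
      whiskering makes it natural.\<close>
    define \<phi> where "\<phi> h \<gamma> = Comp (Vert W) \<epsilon> (whisker_right W \<gamma> ?s)" for h :: 'a and \<gamma>
    have e': "\<epsilon> \<in> hom (hom_cat W (fobj F x) A) (Comp (Under W) r ?s) t"
      using e hs[OF r] by (simp add: hom_hom_cat)
    have phi_hom: "\<phi> h \<gamma> \<in> hom (Vert W) (Comp (Under W) h ?s) t"
      if "h \<in> ?Y" "\<gamma> \<in> hom (Vert W) h r" for h \<gamma>
      using S.Y.Comp_hom[of "whisker_right W \<gamma> ?s" "Comp (Under W) h ?s" "Comp (Under W) r ?s" \<epsilon> t]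
        S.farr_hom[of \<gamma> h r] that e' hs[OF that(1)] by (simp add: hom_hom_cat \<phi>_def)
    have "bij_betw (\<phi> h) (hom (Vert W) h r) (hom (Vert W) (Comp (Under W) h ?s) t)"
      if h: "h \<in> ?Y" for h
    proof (rule bij_betwI')
      fix \<gamma> \<delta> assume "\<gamma> \<in> hom (Vert W) h r" "\<delta> \<in> hom (Vert W) h r"
      then show "\<phi> h \<gamma> = \<phi> h \<delta> \<longleftrightarrow> \<gamma> = \<delta>"
        using u h phi_hom[OF h] unfolding \<phi>_def by metis
    next
      fix \<beta> assume "\<beta> \<in> hom (Vert W) (Comp (Under W) h ?s) t"
      then show "\<exists>\<gamma> \<in> hom (Vert W) h r. \<beta> = \<phi> h \<gamma>"
        using u h unfolding \<phi>_def by metis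
    qed (rule phi_hom[OF h])
    moreover have "\<phi> k (Comp (Vert W) \<gamma> \<beta>) = Comp (Vert W) (\<phi> h \<gamma>) (whisker_right W \<beta> ?s)"
      if "h \<in> ?Y" "k \<in> ?Y" "\<beta> \<in> hom (Vert W) k h" "\<gamma> \<in> hom (Vert W) h r" for h k \<beta> \<gamma>
      using S.Comp_farr_Comp[of \<beta> k h \<gamma> r \<epsilon> t] that e' by (simp add: \<phi>_def hom_hom_cat)
    moreover have "\<epsilon> = \<phi> r (Id (Vert W) r)"
      using S.farr_Id[of r] r S.Y.Comp_Id[of \<epsilon>] e' by (simp add: \<phi>_def)
    ultimately show "exhibits_ran W ?s t r \<epsilon>"
      unfolding exhibits_ran_def ran_iff using r by blast
  qed
qed

section \<open>Polymorphic products and products in the family fibration\<close>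

lemma has_polymorphic_products_iff:
  "has_polymorphic_products W (Disc W C F) A \<longleftrightarrow> has_products C (fam W F A)"
proof
  assume P: "has_polymorphic_products W (Disc W C F) A"
  show "has_products C (fam W F A)"
    unfolding has_products_def
  proof
    fix s assume "s \<in> Arr C"
    then have s: "s \<in> hom C (Dom C s) (Cod C s)" by (simp add: hom_def)
    interpret S: functor_between "fibre (fam W F A) (Cod C s)" "fibre (fam W F A) (Dom C s)"
      "reindex (fam W F A) s"
      by (rule fam.functor_between_reindex[OF s])
    show "\<exists>R \<eta> \<epsilon>. adjunction (fibre (fam W F A) (Cod C s)) (fibre (fam W F A) (Dom C s))
        (reindex (fam W F A) s) R \<eta> \<epsilon>"
    proof (rule S.adjunction_if_universal_arrows)
      fix t assume "t \<in> Obj (fibre (fam W F A) (Dom C s))"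
      then have t: "t \<in> hom (Under W) (fobj F (Dom C s)) A" by simp
      then have "\<exists>r \<epsilon>. exhibits_ran W (farr F s) t r \<epsilon>"
        using P homD[OF farr_hom_Disc[OF s]] by (simp add: has_polymorphic_products_def)
      then show "\<exists>r \<epsilon>. universal_arrow (fibre (fam W F A) (Cod C s)) (fibre (fam W F A) (Dom C s))
          (reindex (fam W F A) s) t r \<epsilon>"
        unfolding exhibits_ran_iff_universal_arrow[OF s t] .
    qed
  qed
next
  assume P: "has_products C (fam W F A)"
  show "has_polymorphic_products W (Disc W C F) A"
    unfolding has_polymorphic_products_def
  proof (intro ballI)
    fix f t assume "f \<in> Arr (Disc W C F)"
    then obtain s x y where s: "s \<in> hom C x y" and f: "f = farr F s" by (rule Disc_arrowE)
    assume t: "t \<in> hom (Under W) (Dom (Disc W C F) f) A"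
    have t: "t \<in> hom (Under W) (fobj F x) A"
      using t f homD[OF farr_hom_Disc[OF s]] by simp
    interpret S: functor_between "fibre (fam W F A) y" "fibre (fam W F A) x" "reindex (fam W F A) s"
      by (rule fam.functor_between_reindex[OF s])
    obtain R \<eta> \<epsilon> where "adjunction (fibre (fam W F A) y) (fibre (fam W F A) x)
        (reindex (fam W F A) s) R \<eta> \<epsilon>"
      using P homD[OF s] unfolding has_products_def by metis
    from S.universal_arrow_counit[OF this] t
    show "\<exists>r \<epsilon>. exhibits_ran W f t r \<epsilon>"
      unfolding f exhibits_ran_iff_universal_arrow[OF s t] by auto
  qed
qed

text \<open>Stability ranges over squares of discrete objects, the Beck-Chevalley condition over
  squares of \<open>C\<close>. Both are broken down to a single square in \<open>C\<close> and a
  single \<open>t\<close>, where \<open>key\<close> compares them.\<close>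

lemma stable_products_iff:
  assumes P: "polymorphic_products W (Disc W C F) A Prd eps"
    and I: "indexed_products C (fam W F A) R \<eta> \<epsilon>"
  shows "stable_products W (Disc W C F) A Prd eps \<longleftrightarrow>
    beck_chevalley_products C (fam W F A) R \<eta> \<epsilon>"
proof -
  have key: "exhibits_ran W (farr F p2) (Comp (Under W) t (farr F p1))
        (Comp (Under W) (Prd (farr F s) t) (farr F i)) (whisker_right W (eps (farr F s) t) (farr F p1)) \<longleftrightarrow>
      is_iso (fibre (fam W F A) z) (bc_map_products C (fam W F A) R \<eta> \<epsilon> s i p1 p2 t)"
    if pb: "is_pullback C s i p1 p2" and s: "s \<in> hom C x y" and i: "i \<in> hom C z y"
      and p1: "p1 \<in> hom C p x" and p2: "p2 \<in> hom C p z" and t: "t \<in> hom (Under W) (fobj F x) A"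
    for s i p1 p2 p x y z t
  proof -
    interpret product_square C "fam W F A" R \<eta> \<epsilon> p x y z s i p1 p2
      using pb s i p1 p2 I by unfold_locales (auto simp: is_pullback_def)
    have "exhibits_ran W (farr F s) t (Prd (farr F s) t) (eps (farr F s) t)"
      using P homD[OF farr_hom_Disc[OF s]] t by (simp add: polymorphic_products_def)
    then have u: "universal_arrow (fibre (fam W F A) y) (fibre (fam W F A) x)
        (reindex (fam W F A) s) t (Prd (farr F s) t) (eps (farr F s) t)"
      unfolding exhibits_ran_iff_universal_arrow[OF s t] .
    have "Comp (Under W) t (farr F p1) \<in> hom (Under W) (fobj F p) A"
      using U.Comp_hom[OF F.farr_hom[OF p1] t] .
    from exhibits_ran_iff_universal_arrow[OF p2 this] universal_arrow_reindex_iff[OF _ u] t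
    show ?thesis by simp
  qed
  show ?thesis
    unfolding fam.beck_chevalley_products_iff[OF I]
  proof
    assume S: "stable_products W (Disc W C F) A Prd eps"
    show "\<forall>s i p1 p2. is_pullback C s i p1 p2 \<longrightarrow> (\<forall>t \<in> Obj (fibre (fam W F A) (Dom C s)).
       is_iso (fibre (fam W F A) (Dom C i)) (bc_map_products C (fam W F A) R \<eta> \<epsilon> s i p1 p2 t))"
    proof (intro allI impI ballI)
      fix s i p1 p2 t
      assume pb: "is_pullback C s i p1 p2" and "t \<in> Obj (fibre (fam W F A) (Dom C s))"
      then have t: "t \<in> hom (Under W) (fobj F (Dom C s)) A" by simp
      have h: "s \<in> hom C (Dom C s) (Cod C s)" "i \<in> hom C (Dom C i) (Cod C s)"
        "p1 \<in> hom C (Dom C p1) (Dom C s)" "p2 \<in> hom C (Dom C p1) (Dom C i)"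
        using pb by (auto simp: is_pullback_def hom_def)
      have "is_pullback (Disc W C F) (farr F s) (farr F i) (farr F p1) (farr F p2)"
        using is_pullback_Disc_iff[OF h] pb by simp
      then show "is_iso (fibre (fam W F A) (Dom C i))
          (bc_map_products C (fam W F A) R \<eta> \<epsilon> s i p1 p2 t)"
        using key[OF pb h t] S t homD[OF farr_hom_Disc[OF h(1)]] by (simp add: stable_products_def)
    qed
  next
    assume B: "\<forall>s i p1 p2. is_pullback C s i p1 p2 \<longrightarrow>
       (\<forall>t \<in> Obj (fibre (fam W F A) (Dom C s)).
       is_iso (fibre (fam W F A) (Dom C i)) (bc_map_products C (fam W F A) R \<eta> \<epsilon> s i p1 p2 t))"
    show "stable_products W (Disc W C F) A Prd eps"
      unfolding stable_products_def
    proof (intro allI impI ballI)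
      fix f g q1 q2 t
      assume "is_pullback (Disc W C F) f g q1 q2" and t: "t \<in> hom (Under W) (Dom (Disc W C F) f) A"
      then obtain s i p1 p2 p x y z where
        h: "s \<in> hom C x y" "i \<in> hom C z y" "p1 \<in> hom C p x" "p2 \<in> hom C p z"
        and eq: "f = farr F s" "g = farr F i" "q1 = farr F p1" "q2 = farr F p2"
        and pb: "is_pullback C s i p1 p2"
        by (elim Disc_pullbackE)
      have t: "t \<in> hom (Under W) (fobj F x) A" using t eq homD[OF farr_hom_Disc[OF h(1)]] by simp
      then have "is_iso (fibre (fam W F A) z) (bc_map_products C (fam W F A) R \<eta> \<epsilon> s i p1 p2 t)"
        using B pb homD[OF h(1)] homD[OF h(2)] by fastforce
      then show "exhibits_ran W q2 (Comp (Under W) t q1) (Comp (Under W) (Prd f t) g)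
          (whisker_right W (eps f t) q1)"
        using key[OF pb h t] eq by simp
    qed
  qed
qed

end

section \<open>Duality\<close>

definition op_cat :: "('o, 'm) cat \<Rightarrow> ('o, 'm) cat" where
  "op_cat C = \<lparr>Obj = Obj C, Arr = Arr C, Dom = Cod C, Cod = Dom C, Id = Id C,
     Comp = \<lambda>g f. Comp C f g\<rparr>"

lemma op_cat_simps [simp]:
  "Obj (op_cat C) = Obj C" "Arr (op_cat C) = Arr C" "Dom (op_cat C) = Cod C" "Cod (op_cat C) = Dom C"
  "Id (op_cat C) = Id C" "Comp (op_cat C) g f = Comp C f g" "hom (op_cat C) x y = hom C y x"
  by (auto simp: op_cat_def hom_def)

lemma category_op_cat:
  assumes "category C"
  shows "category (op_cat C)"
proof -
  interpret category C by fact
  show ?thesis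
    by unfold_locales (auto simp: Dom_Obj Cod_Obj Id_hom Comp_Id Id_Comp intro: Comp_hom Comp_assoc[symmetric])
qed

lemma is_functor_op_cat [simp]: "is_functor (op_cat C) (op_cat D) F \<longleftrightarrow> is_functor C D F"
  unfolding is_functor_def by (simp, blast)

lemma nat_trans_op_cat: "nat_trans (op_cat C) (op_cat D) G F \<theta> \<longleftrightarrow> nat_trans C D F G \<theta>"
  unfolding nat_trans_def by (simp, metis)

lemma is_iso_op_cat: "is_iso (op_cat C) f \<longleftrightarrow> is_iso C f"
  unfolding is_iso_def by auto

lemma nat_iso_op_cat: "nat_iso (op_cat C) (op_cat D) G F \<theta> \<longleftrightarrow> nat_iso C D F G \<theta>"
  by (simp add: nat_iso_def nat_trans_op_cat is_iso_op_cat)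

text \<open>Reversing arrows exchanges the two adjoints, the unit with the counit, and the two
  triangle identities with each other. Hence the swapped order of \<open>\<epsilon>\<close> and
  \<open>\<eta>\<close> here.\<close>

lemma adjunction_op_cat: "adjunction (op_cat D) (op_cat C) R L \<epsilon> \<eta> \<longleftrightarrow> adjunction C D L R \<eta> \<epsilon>"
  unfolding adjunction_def nat_trans_op_cat by auto

text \<open>\<open>Under\<close> and \<open>HComp\<close> are kept, so the discrete objects, their
  pullbacks and whiskering agree in \<open>W\<close> and \<open>co W\<close>, while right and left
  Kan extensions trade places.\<close>

definition co :: "('o, 'a, 'c) twocat \<Rightarrow> ('o, 'a, 'c) twocat" where
  "co W = \<lparr>Under = Under W, Vert = op_cat (Vert W), HComp = HComp W\<rparr>"

lemma co_simps [simp]: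
  "Under (co W) = Under W" "Vert (co W) = op_cat (Vert W)" "HComp (co W) = HComp W"
  "whisker_right (co W) = whisker_right W" "Disc (co W) C F = Disc W C F"
  by (auto simp: co_def whisker_right_def Disc_def fun_eq_iff)

text \<open>The axioms on horizontal composition place only the sources of 2-cells in a hom-set. In
  \<open>co W\<close> these sources are the former targets, so membership has to be moved across a
  2-cell.\<close>

lemma (in two_category) two_cell_hom_iff:
  assumes "\<alpha> \<in> hom (Vert W) f g"
  shows "f \<in> hom (Under W) x y \<longleftrightarrow> g \<in> hom (Under W) x y"
  using globular[OF assms] category.hom_Obj[OF Vert_category assms] Obj_Vert
  by (auto simp: hom_def)

lemma (in two_category) two_category_co: "two_category (co W)"
proof -
  interpret H: category "Horiz W" by (rule Horiz_category)
  have "Obj (Horiz (co W)) = Obj (Horiz W)" "Arr (Horiz (co W)) = Arr (Horiz W)"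
    "Id (Horiz (co W)) = Id (Horiz W)" "Comp (Horiz (co W)) = Comp (Horiz W)"
    by (simp_all add: Horiz_def)
  \<comment> \<open>\<open>Horiz\<close> takes its domain from the source 1-cell and its codomain
    from the target 1-cell. Reversal swaps the two 1-cells, and globularity says that they are
    parallel.\<close>
  moreover have ends: "Dom (Horiz (co W)) \<alpha> = Dom (Horiz W) \<alpha> \<and> Cod (Horiz (co W)) \<alpha> = Cod (Horiz W) \<alpha>"
    if "\<alpha> \<in> Arr (Vert W)" for \<alpha>
    using globular[of \<alpha> "Dom (Vert W) \<alpha>" "Cod (Vert W) \<alpha>"] that by (simp add: hom_def Horiz_def)
  moreover have "hom (Horiz (co W)) x y = hom (Horiz W) x y" for x y
    using ends by (auto simp: hom_def) (auto simp: Horiz_def)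
  ultimately have H: "category (Horiz (co W))"
    unfolding category_def
    using H.Dom_Obj H.Cod_Obj H.Id_hom H.Comp_hom H.Comp_Id H.Id_Comp H.Comp_assoc
    by (auto simp: Horiz_def)
  show ?thesis
  proof (rule two_category.intro)
    show "category (Under (co W))" "category (Vert (co W))"
      using Under_category category_op_cat[OF Vert_category] by simp_all
  next
    fix \<alpha> \<beta> f f' g g' x y z
    assume "f \<in> hom (Under (co W)) x y" "g \<in> hom (Under (co W)) y z"
      "\<alpha> \<in> hom (Vert (co W)) f f'" "\<beta> \<in> hom (Vert (co W)) g g'"
    then show "HComp (co W) \<beta> \<alpha> \<in> hom (Vert (co W)) (Comp (Under (co W)) g f) (Comp (Under (co W)) g' f')"
      using HComp_hom[of f' x y g' z \<alpha> f \<beta> g] two_cell_hom_iff[of \<alpha> f' f] two_cell_hom_iff[of \<beta> g' g]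
      by simp
  next
    fix \<alpha> \<alpha>' \<beta> \<beta>' f f' f'' g g' g'' x y z
    assume "f \<in> hom (Under (co W)) x y" "g \<in> hom (Under (co W)) y z"
      "\<alpha> \<in> hom (Vert (co W)) f f'" "\<alpha>' \<in> hom (Vert (co W)) f' f''"
      "\<beta> \<in> hom (Vert (co W)) g g'" "\<beta>' \<in> hom (Vert (co W)) g' g''"
    then show "HComp (co W) (Comp (Vert (co W)) \<beta>' \<beta>) (Comp (Vert (co W)) \<alpha>' \<alpha>) =
        Comp (Vert (co W)) (HComp (co W) \<beta>' \<alpha>') (HComp (co W) \<beta> \<alpha>)"
      \<comment> \<open>Vertical composites run backwards in \<open>co W\<close>: the axiom for
        \<open>W\<close> is applied from \<open>f''\<close> and \<open>g''\<close> towards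
        \<open>f\<close> and \<open>g\<close>.\<close>
      using interchange[of f'' x y g'' z \<alpha>' f' \<alpha> f \<beta>' g' \<beta> g]
        two_cell_hom_iff[of \<alpha> f' f] two_cell_hom_iff[of \<beta> g' g]
        two_cell_hom_iff[of \<alpha>' f'' f'] two_cell_hom_iff[of \<beta>' g'' g']
      by simp
  qed (use H Obj_Vert globular HComp_Id in \<open>auto\<close>)
qed

text \<open>\<open>hom_cat\<close> tests only the source of a 2-cell, and reversal makes it test the
  target; \<open>two_cell_hom_iff\<close> identifies the two tests. Being an equality of records,
  this dualises the fibres by rewriting.\<close>

lemma (in two_category) hom_cat_co: "hom_cat (co W) x y = op_cat (hom_cat W x y)"
  using two_cell_hom_iff by (fastforce simp: hom_cat_def op_cat_def hom_def)

section \<open>Coproducts as products in \<open>co W\<close>\<close>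

context discreteness
begin

text \<open>A discrete category is its own opposite, so 2-full faithfulness survives the reversal;
  the adjunction with \<open>F\<close> lives in \<open>Under W\<close>, which is unchanged.\<close>

lemma discreteness_co: "discreteness (co W) C F"
proof -
  have "two_fully_faithful C (co W) F"
    using discreteness
    unfolding notion_of_discreteness_def two_fully_faithful_def is_iso_of_categories_def is_functor_def
    by (auto simp: hom_cat_co discrete_cat_def hom_def)
  then show ?thesis
    using discreteness two_category_co
    by (simp add: discreteness_def discreteness_axioms_def notion_of_discreteness_def)
qed

lemma fam_co:
  "fibre (fam (co W) F A) x = op_cat (fibre (fam W F A) x)"
  "reindex (fam (co W) F A) = reindex (fam W F A)"
  by (simp_all add: fam_def hom_cat_co)

text \<open>With 2-cells reversed, \<open>ran_bijection\<close> unfolds to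
  \<open>lan_bijection\<close> for the same \<open>\<phi>\<close>, so the universal 2-cell is the
  same as well.\<close>

lemma exhibits_ran_co: "exhibits_ran (co W) = exhibits_lan W"
  by (simp add: fun_eq_iff exhibits_ran_def exhibits_lan_def ran_bijection_def lan_bijection_def)

lemma has_polymorphic_coproducts_iff:
  "has_polymorphic_coproducts W (Disc W C F) A \<longleftrightarrow> has_coproducts C (fam W F A)"
proof -
  interpret co: discreteness "co W" C F by (rule discreteness_co)
  have "has_products C (fam (co W) F A) \<longleftrightarrow> has_coproducts C (fam W F A)"
    unfolding has_products_def has_coproducts_def fam_co adjunction_op_cat by blast
  then show ?thesis
    using co.has_polymorphic_products_iff[of A]
    by (simp add: has_polymorphic_products_def has_polymorphic_coproducts_def exhibits_ran_co)
qed

lemma stable_coproducts_iff: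
  assumes "polymorphic_coproducts W (Disc W C F) A Cop eta"
    and "indexed_coproducts C (fam W F A) L \<eta> \<epsilon>"
  shows "stable_coproducts W (Disc W C F) A Cop eta \<longleftrightarrow>
    beck_chevalley_coproducts C (fam W F A) L \<eta> \<epsilon>"
proof -
  interpret co: discreteness "co W" C F by (rule discreteness_co)
  \<comment> \<open>Unit and counit change places, as in \<open>adjunction_op_cat\<close>.\<close>
  have "indexed_products C (fam (co W) F A) L \<epsilon> \<eta>"
    using assms(2) unfolding indexed_products_def indexed_coproducts_def fam_co adjunction_op_cat .
  moreover have "polymorphic_products (co W) (Disc (co W) C F) A Cop eta"
    using assms(1) by (simp add: polymorphic_products_def polymorphic_coproducts_def exhibits_ran_co)
  ultimately have "stable_products (co W) (Disc (co W) C F) A Cop eta \<longleftrightarrow>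
      beck_chevalley_products C (fam (co W) F A) L \<epsilon> \<eta>"
    by (rule co.stable_products_iff[rotated])
  \<comment> \<open>Composition in the opposite fibre reverses the two factors of the mate, which
    turns one Beck-Chevalley formula into the other; \<open>nat_iso_op_cat\<close> then reverses the
    direction of the transformation.\<close>
  moreover have "bc_map_products C (fam (co W) F A) L \<epsilon> \<eta> = bc_map_coproducts C (fam W F A) L \<eta> \<epsilon>"
    by (simp add: fun_eq_iff bc_map_products_def bc_map_coproducts_def fam_co del: fam_simps co.fam_simps)
  then have "beck_chevalley_products C (fam (co W) F A) L \<epsilon> \<eta> \<longleftrightarrow>
      beck_chevalley_coproducts C (fam W F A) L \<eta> \<epsilon>"
    by (simp add: beck_chevalley_products_def beck_chevalley_coproducts_def fam_co nat_iso_op_cat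
        del: fam_simps co.fam_simps)
  ultimately show ?thesis
    by (simp add: stable_products_def stable_coproducts_def exhibits_ran_co)
qed

end

theorem corollary9:
  fixes W :: "('o, 'a, 'c) twocat"
    and C :: "('p, 'q) cat"
    and F :: "('p, 'q, 'o, 'a) fctr"
    and A :: 'o
  assumes "two_category W"
    and "notion_of_discreteness W C F"
    and "A \<in> Obj (Under W)"
  shows
    "(has_polymorphic_products W (Disc W C F) A \<longleftrightarrow> has_products C (fam W F A)) \<and>
     (has_polymorphic_coproducts W (Disc W C F) A \<longleftrightarrow> has_coproducts C (fam W F A)) \<and>
     (has_finite_limits W \<longrightarrow>
       (\<forall>Prd eps R \<eta> \<epsilon>.
          polymorphic_products W (Disc W C F) A Prd eps \<and>
          indexed_products C (fam W F A) R \<eta> \<epsilon> \<longrightarrow>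
          (stable_products W (Disc W C F) A Prd eps \<longleftrightarrow>
           beck_chevalley_products C (fam W F A) R \<eta> \<epsilon>)) \<and>
       (\<forall>Cop eta L \<eta> \<epsilon>.
          polymorphic_coproducts W (Disc W C F) A Cop eta \<and>
          indexed_coproducts C (fam W F A) L \<eta> \<epsilon> \<longrightarrow>
          (stable_coproducts W (Disc W C F) A Cop eta \<longleftrightarrow>
           beck_chevalley_coproducts C (fam W F A) L \<eta> \<epsilon>)))"
proof -
  interpret discreteness W C F
    using assms(1,2) by (simp add: discreteness_def discreteness_axioms_def)
  show ?thesis
    using has_polymorphic_products_iff has_polymorphic_coproducts_iff
      stable_products_iff stable_coproducts_iff by blast
qed

end
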